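(* Let $d\geq 2$, let $\rho\in(0,\frac12)$, let $Q_{0}\subseteq\mathbb{R}^{d}$ be a cube, let $E\subseteq Q_{0}$ be measurable, and suppose $\delta=\frac{|E|}{|Q_{0}|}>0$. Let $f:E\to\mathbb{R}^{d}$ be $\eta$-quasisymmetric. Then there is a compact set $E'\subseteq E$ with $|E'|\geq(1-\rho)|E|$ such that $\left(\frac{\operatorname{diam} f(E')}{\operatorname{diam} E'}\right)^{-1}f|_{E'}$ is $L$-bi-Lipschitz for some $L$ depending only on $\eta$, $d$, $\rho$, and $\delta$.
   Context: $|E|$ denotes Lebesgue measure. For an increasing homeomorphism $\eta:(0,\infty)\to(0,\infty)$, a non-constant map $f:E\to\mathbb{R}^{d}$ is $\eta$-quasisymmetric if for all distinct $x,y,z\in E$, $\frac{|f(x)-f(y)|}{|f(x)-f(z)|}\leq\eta\left(\frac{|x-y|}{|x-z|}\right)$. A map $g$ is $L$-bi-Lipschitz if $L^{-1}|x-y|\leq|g(x)-g(y)|\leq L|x-y|$ for all $x,y$ in its domain. *)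

theory Defs
  imports "HOL-Analysis.Analysis"
begin

text \<open>Only closed cubes are considered. Nothing is lost for a set contained in an open or
  half-open cube, because passing to the closure of the cube does not change its measure.
  The cube may be rotated; axis-parallel cubes are the case where \<open>T\<close> is the identity.\<close>

definition is_cube :: "(real^'n) set \<Rightarrow> bool" where
  "is_cube Q \<longleftrightarrow>
     (\<exists>(a :: real^'n) s (T :: real^'n \<Rightarrow> real^'n). 0 < s \<and> orthogonal_transformation T \<and>
        Q = (\<lambda>x. a + T x) ` cbox 0 (\<chi> i. s))"

text \<open>A homeomorphism of \<open>(0,\<infinity>)\<close> is represented by a total function on the reals whose
  values outside \<open>(0,\<infinity>)\<close> are irrelevant.\<close>

definition increasing_homeomorphism :: "(real \<Rightarrow> real) \<Rightarrow> bool" where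
  "increasing_homeomorphism \<eta> \<longleftrightarrow>
     strict_mono_on {0<..} \<eta> \<and> (\<exists>\<theta>. homeomorphism {0<..} {0<..} \<eta> \<theta>)"

text \<open>The quotient on the left has to be defined. Since division by zero yields zero in HOL,
  the conjunct \<open>f x \<noteq> f z\<close> is needed to prevent the inequality from holding vacuously
  where \<open>f\<close> identifies points. (For a non-constant map on at least three points it is what
  the inequality \<open>\<bar>f x - f y\<bar> \<le> \<eta> (\<bar>x - y\<bar> / \<bar>x - z\<bar>) \<cdot> \<bar>f x - f z\<bar>\<close> implies.)\<close>

definition quasisymmetric_on ::
  "(real \<Rightarrow> real) \<Rightarrow> 'a::metric_space set \<Rightarrow> ('a \<Rightarrow> 'b::metric_space) \<Rightarrow> bool" where
  "quasisymmetric_on \<eta> E f \<longleftrightarrow>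
     \<not> f constant_on E \<and>
     (\<forall>x\<in>E. \<forall>y\<in>E. \<forall>z\<in>E. x \<noteq> y \<longrightarrow> y \<noteq> z \<longrightarrow> x \<noteq> z \<longrightarrow>
        f x \<noteq> f z \<and> dist (f x) (f y) / dist (f x) (f z) \<le> \<eta> (dist x y / dist x z))"

definition bi_lipschitz_on ::
  "real \<Rightarrow> 'a::metric_space set \<Rightarrow> ('a \<Rightarrow> 'b::metric_space) \<Rightarrow> bool" where
  "bi_lipschitz_on L E g \<longleftrightarrow>
     (\<forall>x\<in>E. \<forall>y\<in>E. inverse L * dist x y \<le> dist (g x) (g y) \<and> dist (g x) (g y) \<le> L * dist x y)"

end

theory Submission imports Defs begin

text \<open>
  After a similarity, \<open>E\<close> is a subset of the unit cube. Let \<open>D\<close> be the diameter of \<open>f ` E\<close>, and call the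
  diameter of \<open>f ` (E \<inter> Q)\<close> divided by the side of \<open>Q\<close> the slope of \<open>f\<close> on the cube \<open>Q\<close>. It has to be
  shown that, apart from a set of small measure, every point sees only slopes comparable to \<open>D\<close>.

  Slopes are rarely large. Balls that are disjoint in the domain have images about which
  disjoint balls of comparable diameter can be placed, and these have bounded total volume.
  With Vitali's covering theorem this gives a weak \<open>(d, d)\<close> inequality for the maximal slope
  (\<open>weak_type_estimate\<close>). Points in the holes of \<open>E\<close> are covered as well, because balls about them can be
  compared with balls about nearby points of \<open>E\<close> (\<open>steep_cubes_bound\<close>).

  Slopes are rarely small. The main point (\<open>flat_cubes_miss_a_fraction\<close>) is that in a cube \<open>Q\<close>, in
  which \<open>E\<close> has density at least \<open>\<tau>\<close>, the subcubes of density at least \<open>\<tau>\<close> whose slope is at most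
  \<open>\<epsilon>\<close> times that of \<open>Q\<close> miss a fraction \<open>c\<close> of \<open>Q\<close>. If they did not, one could walk
  through \<open>Q\<close> from one part of \<open>E\<close> to another, mostly inside flat cubes, where \<open>f\<close> varies little. The
  remaining set, which contains the holes of \<open>E\<close> that are not covered, has measure at most \<open>c\<close>, and
  there the variation is controlled by the integral of the maximal slope. A weak \<open>(d, d)\<close> function
  is uniformly integrable if \<open>d \<ge> 2\<close>, so this contribution is small too, and \<open>f\<close> would vary less than
  it does. The walk is made precise by a Poincare inequality for piecewise constant
  functions (\<open>piecewise_constant_poincare\<close>). No extension of \<open>f\<close> to the holes of \<open>E\<close> is used: a cube in
  a hole takes the value of \<open>f\<close> at a nearby point of \<open>E\<close>.

  Iterating this over dyadic cubes, the set of points that lie in a dyadic cube of slope below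
  \<open>\<theta> ^ j D\<close> decays geometrically with \<open>j\<close> (\<open>low_set_decay\<close>). Cubes in which the density of \<open>E\<close> is below \<open>\<tau>\<close>
  are exempt from the argument, but these contain at most the measure \<open>\<tau>\<close> of \<open>E\<close>
  (\<open>thin_set_bound\<close>), and are discarded. Upper and lower bounds for the slopes at all scales about
  a point amount to bi-Lipschitz bounds at this point (\<open>bilipschitz_after_small_removal\<close>).
\<close>

section \<open>Distortion and the weak-type estimate\<close>

text \<open>Quasisymmetry in multiplicative form. Degenerate triples are included, which is why \<open>H \<ge> 1\<close> is
demanded. The notion passes to subsets and is invariant under similarities of the domain, and only
finitely many values of \<open>H\<close> enter the estimates; they give the dependence of \<open>L\<close> on \<open>\<eta>\<close>.\<close>

definition distortion :: "(real \<Rightarrow> real) \<Rightarrow> 'a::metric_space set \<Rightarrow> ('a \<Rightarrow> 'b::metric_space) \<Rightarrow> bool" where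
  "distortion H E f \<longleftrightarrow> (\<forall>t>0. 1 \<le> H t) \<and>
     (\<forall>x\<in>E. \<forall>y\<in>E. \<forall>z\<in>E. \<forall>t>0. dist x y \<le> t * dist x z \<longrightarrow>
        dist (f x) (f y) \<le> H t * dist (f x) (f z))"

lemma distortionD:
  assumes "distortion H E f" "x \<in> E" "y \<in> E" "z \<in> E" "0 < t" "dist x y \<le> t * dist x z"
  shows "dist (f x) (f y) \<le> H t * dist (f x) (f z)"
  using assms unfolding distortion_def by blast

lemma distortion_ge_1: "distortion H E f \<Longrightarrow> 0 < t \<Longrightarrow> 1 \<le> H t"
  unfolding distortion_def by blast

lemma distortion_subset: "distortion H E f \<Longrightarrow> F \<subseteq> E \<Longrightarrow> distortion H F f"
  unfolding distortion_def by (simp add: subset_iff)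

lemma quasisymmetric_imp_distortion:
  assumes \<eta>: "increasing_homeomorphism \<eta>" and qs: "quasisymmetric_on \<eta> E f"
  shows "distortion (\<lambda>t. max 1 (\<eta> t)) E f"
  unfolding distortion_def
proof (intro conjI ballI allI impI)
  fix x y z and t :: real
  assume E: "x \<in> E" "y \<in> E" "z \<in> E" and t: "0 < t" and le: "dist x y \<le> t * dist x z"
  show "dist (f x) (f y) \<le> max 1 (\<eta> t) * dist (f x) (f z)"
  proof (cases "x = y \<or> x = z \<or> y = z")
    case True
    then have "x = y \<or> y = z" using le by auto
    moreover have "1 * dist (f x) (f z) \<le> max 1 (\<eta> t) * dist (f x) (f z)"
      by (rule mult_right_mono) auto
    ultimately show ?thesis by auto
  next
    case False
    let ?q = "dist x y / dist x z"
    have "?q \<le> t" "0 < ?q" using False le by (auto simp: divide_simps)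
    then have "\<eta> ?q \<le> \<eta> t"
      using \<eta> t strict_mono_onD[of "{0<..}" \<eta> ?q t] unfolding increasing_homeomorphism_def
      by (cases "?q = t") auto
    moreover have "f x \<noteq> f z" "dist (f x) (f y) / dist (f x) (f z) \<le> \<eta> ?q"
      using qs E False unfolding quasisymmetric_on_def by blast+
    ultimately have "dist (f x) (f y) / dist (f x) (f z) \<le> max 1 (\<eta> t)" "0 < dist (f x) (f z)" by auto
    then show ?thesis by (simp add: pos_divide_le_eq)
  qed
qed auto

lemma distortion_bounded_image:
  assumes d: "distortion H E f" and E: "bounded E"
  shows "bounded (f ` E)"
proof (cases "\<exists>x\<in>E. \<exists>z\<in>E. x \<noteq> z")
  case True
  then obtain x z where xz: "x \<in> E" "z \<in> E" "x \<noteq> z" by blast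
  define t where "t = (diameter E + 1) / dist x z"
  have t: "0 < t" "t * dist x z = diameter E + 1"
    using xz diameter_ge_0[OF E] by (auto simp: t_def add_nonneg_pos)
  have "dist (f x) (f y) \<le> H t * dist (f x) (f z)" if "y \<in> E" for y
    using distortionD[OF d xz(1) that xz(2) t(1)] t(2) diameter_bounded_bound[OF E xz(1) that]
    by simp
  then show ?thesis
    unfolding bounded_def by blast
next
  case False
  then have "E = {} \<or> (\<exists>x. E = {x})" by blast
  then show ?thesis by auto
qed

lemma fmeasurable_ball: "ball (x :: 'a::euclidean_space) r \<in> fmeasurable lborel"
  using emeasure_lborel_ball_finite[of x r] by (auto simp: fmeasurable_def)

text \<open>The weak \<open>(d, d)\<close> inequality for the maximal slope of \<open>f\<close>. Take a Vitali subfamily of disjoint balls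
with centres \<open>x\<^sub>i\<close> and radii \<open>r\<^sub>i\<close>. Since \<open>x\<^sub>j\<close> is at least as far from \<open>x\<^sub>i\<close> as any point of the
ball about \<open>x\<^sub>i\<close>, the image of that ball has diameter at most \<open>2 H 1\<close> times the distance from
\<open>f x\<^sub>i\<close> to \<open>f x\<^sub>j\<close>. Hence the image balls of radius \<open>\<kappa> r\<^sub>i / (4 H 1)\<close> are disjoint, and comparing
their volume with that of a ball containing \<open>f ` E\<close> bounds the sum of the \<open>r\<^sub>i ^ d\<close>. It does not
matter how sparse \<open>E\<close> is.\<close>

lemma weak_type_estimate:
  fixes f :: "real^'n \<Rightarrow> real^'n" and K :: "((real^'n) \<times> real) set"
  assumes d: "distortion H E f" and bd: "bounded (f ` E)" and lam: "0 < \<kappa>"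
    and K: "\<And>x r. (x, r) \<in> K \<Longrightarrow> x \<in> E \<and> 0 < r \<and> r \<le> B \<and> \<kappa> * r < diameter (f ` (E \<inter> ball x r))"
  defines "V \<equiv> unit_ball_vol (CARD('n)) * (40 * H 1 * diameter (f ` E) / \<kappa>) ^ CARD('n)"
  shows "(\<Union>(x,r)\<in>K. ball x r) \<in> fmeasurable lborel" (is "?U \<in> _")
    and "measure lborel (\<Union>(x,r)\<in>K. ball x r) \<le> V"
proof -
  define D where "D = diameter (f ` E)"
  have H1: "1 \<le> H 1" using distortion_ge_1[OF d] by simp
  have D0: "0 \<le> D" using diameter_ge_0[OF bd] by (simp add: D_def)
  have bdS: "bounded (f ` (E \<inter> S))" for S by (rule bounded_subset[OF bd]) auto
  obtain C where C: "countable C" "C \<subseteq> K"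
    and disj: "pairwise (\<lambda>i j. disjnt (ball (fst i) (snd i)) (ball (fst j) (snd j))) C"
    and cov: "?U \<subseteq> (\<Union>i\<in>C. ball (fst i) (5 * snd i))"
    by (rule Vitali_covering_lemma_balls[where S="?U" and K=K and a=fst and r=snd and B=B]) (use K in auto)
  have far: "\<kappa> * snd i < 2 * H 1 * dist (f (fst i)) (f (fst j))" 
    if ij: "i \<in> C" "j \<in> C" "i \<noteq> j" for i j
  proof -
    obtain x r where i: "i = (x, r)" by (cases i)
    obtain y s where j: "j = (y, s)" by (cases j)
    have x: "x \<in> E" "0 < r" "\<kappa> * r < diameter (f ` (E \<inter> ball x r))" and y: "y \<in> E" "0 < s"
      using K[of x r] K[of y s] ij C(2) i j by auto
    have "disjnt (ball x r) (ball y s)"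
      using pairwiseD[OF disj ij] i j by simp
    then have "y \<notin> ball x r"
      using y by (metis centre_in_ball disjnt_iff)
    then have xy: "r \<le> dist x y" by simp
    have near: "dist (f x) (f w) \<le> H 1 * dist (f x) (f y)" if "w \<in> E \<inter> ball x r" for w
      using distortionD[OF d x(1), of w y 1] that y xy by auto
    obtain v w where vw: "v \<in> E \<inter> ball x r" "w \<in> E \<inter> ball x r" "\<kappa> * r < dist (f v) (f w)"
      using diameter_lower_bounded[OF bdS _ x(3)] lam x(2) by auto
    have "dist (f v) (f w) \<le> dist (f x) (f v) + dist (f x) (f w)"
      by (metis dist_commute dist_triangle)
    then show ?thesis using near[OF vw(1)] near[OF vw(2)] vw(3) i j by simp
  qed
  \<comment> \<open>\<open>q * r\<close> is less than half the distance from one image centre to any other.\<close>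
  define q where "q = \<kappa> / (4 * H 1)"
  have q: "0 < q" using lam H1 by (simp add: q_def)
  have qle: "q * snd i \<le> D" if "i \<in> C" for i
  proof -
    obtain x r where i: "i = (x, r)" by (cases i)
    have x: "0 < r" "\<kappa> * r < diameter (f ` (E \<inter> ball x r))"
      using K[of x r] that C(2) i by auto
    have "diameter (f ` (E \<inter> ball x r)) \<le> D"
      unfolding D_def by (rule diameter_subset[OF _ bd]) auto
    then have "\<kappa> * r \<le> D" using x by simp
    moreover have "q * r \<le> \<kappa> * r"
    proof (rule mult_right_mono)
      have "\<kappa> * 1 \<le> \<kappa> * (4 * H 1)" by (rule mult_left_mono) (use H1 lam in auto)
      then show "q \<le> \<kappa>" using H1 lam by (simp add: q_def pos_divide_le_eq)
    qed (use x in simp)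
    ultimately show ?thesis using i by simp
  qed
  have balls: "disjnt (ball (f (fst i)) (q * snd i)) (ball (f (fst j)) (q * snd j))"
    if ij: "i \<in> C" "j \<in> C" "i \<noteq> j" for i j
  proof -
    have "q * snd i < dist (f (fst i)) (f (fst j)) / 2"
      using far[OF ij] H1 by (simp add: q_def divide_simps mult.commute)
    moreover have "q * snd j < dist (f (fst i)) (f (fst j)) / 2"
      using far[OF ij(2,1)] ij(3) H1 by (simp add: q_def divide_simps mult.commute dist_commute)
    ultimately have less: "q * snd i + q * snd j < dist (f (fst i)) (f (fst j))" by simp
    show ?thesis unfolding disjnt_iff
    proof (intro allI notI)
      fix p assume "p \<in> ball (f (fst i)) (q * snd i) \<and> p \<in> ball (f (fst j)) (q * snd j)"
      then have "dist (f (fst i)) (f (fst j)) < q * snd i + q * snd j"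
        using dist_triangle2[of "f (fst i)" "f (fst j)" p]
        by (auto simp: dist_commute)
      then show False using less by simp
    qed
  qed
  let ?d = "CARD('n)" and ?\<omega> = "unit_ball_vol (real CARD('n))"
  have pack: "(\<Sum>i\<in>J. snd i ^ ?d) \<le> (2 * D / q) ^ ?d" if J: "J \<subseteq> C" "finite J" for J
  proof (cases "J = {}")
    case False
    then obtain i0 where i0: "i0 \<in> J" by blast
    have pos: "0 < snd i" "fst i \<in> E" if "i \<in> J" for i
      using K[of "fst i" "snd i"] that J C(2) by auto
    have "(\<Sum>i\<in>J. ?\<omega> * (q * snd i) ^ ?d) = (\<Sum>i\<in>J. measure lborel (ball (f (fst i)) (q * snd i)))"
      by (rule sum.cong) (use pos q in \<open>auto simp: content_ball less_imp_le\<close>)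
    also have "\<dots> = measure lborel (\<Union>i\<in>J. ball (f (fst i)) (q * snd i))"
    proof (rule measure_finite_Union[symmetric])
      show "disjoint_family_on (\<lambda>i. ball (f (fst i)) (q * snd i)) J"
        using J balls unfolding disjoint_family_on_def disjnt_def by blast
      show "emeasure lborel (ball (f (fst i)) (q * snd i)) \<noteq> \<infinity>" for i
        using emeasure_lborel_ball_finite[of "f (fst i)" "q * snd i"] by (simp add: less_top)
    qed (use J in auto)
    also have "\<dots> \<le> measure lborel (ball (f (fst i0)) (2 * D))"
    proof (rule measure_mono_fmeasurable)
      show "(\<Union>i\<in>J. ball (f (fst i)) (q * snd i)) \<subseteq> ball (f (fst i0)) (2 * D)"
      proof
        fix p assume "p \<in> (\<Union>i\<in>J. ball (f (fst i)) (q * snd i))"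
        then obtain i where i: "i \<in> J" "dist (f (fst i)) p < q * snd i" by auto
        have "dist (f (fst i0)) (f (fst i)) \<le> D"
          unfolding D_def by (rule diameter_bounded_bound[OF bd]) (use pos i0 i in auto)
        moreover have "dist (f (fst i)) p < D" using i qle[of i] J by auto
        ultimately show "p \<in> ball (f (fst i0)) (2 * D)"
          using dist_triangle[of "f (fst i0)" p "f (fst i)"] by simp
      qed
    qed (auto intro!: borel_open open_UN fmeasurable_ball)
    also have "\<dots> = ?\<omega> * (2 * D) ^ ?d" using D0 by (simp add: content_ball)
    finally have "q ^ ?d * (\<Sum>i\<in>J. snd i ^ ?d) \<le> (2 * D) ^ ?d"
      by (simp add: sum_distrib_left[symmetric] power_mult_distrib)
    then show ?thesis using q by (simp add: power_divide pos_le_divide_eq mult.commute)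
  qed (use D0 q in auto)
  have bound: "(\<Sum>i\<in>J. measure lborel (ball (fst i) (5 * snd i))) \<le> V" if J: "J \<subseteq> C" "finite J" for J
  proof -
    have pos: "0 < snd i" if "i \<in> J" for i
      using K[of "fst i" "snd i"] that J C(2) by auto
    have "(\<Sum>i\<in>J. measure lborel (ball (fst i) (5 * snd i))) = (\<Sum>i\<in>J. ?\<omega> * 5 ^ ?d * snd i ^ ?d)"
      by (rule sum.cong) (use pos in \<open>auto simp: content_ball less_imp_le power_mult_distrib\<close>)
    also have "\<dots> = ?\<omega> * 5 ^ ?d * (\<Sum>i\<in>J. snd i ^ ?d)" by (simp add: sum_distrib_left)
    also have "\<dots> \<le> ?\<omega> * 5 ^ ?d * (2 * D / q) ^ ?d"
      by (intro mult_left_mono pack J) auto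
    also have "\<dots> = ?\<omega> * (5 * (2 * D / q)) ^ ?d" by (simp only: power_mult_distrib mult.assoc)
    also have "5 * (2 * D / q) = 40 * H 1 * D / \<kappa>"
      using H1 lam by (simp add: q_def)
    finally show ?thesis by (simp add: V_def D_def)
  qed
  have bound': "measure lborel (\<Union>i\<in>J. ball (fst i) (5 * snd i)) \<le> V"
    if J: "J \<subseteq> C" "finite J" for J
    by (rule order_trans[OF measure_UNION_le bound[OF J]]) (use J in auto)
  have W: "(\<Union>i\<in>C. ball (fst i) (5 * snd i)) \<in> fmeasurable lborel"
    by (rule fmeasurable_UN_bound[OF C(1) fmeasurable_ball bound'])
  have m: "measure lborel (\<Union>i\<in>C. ball (fst i) (5 * snd i)) \<le> V"
    by (rule measure_UN_bound[OF C(1) fmeasurable_ball bound'])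
  have "open ?U" by auto
  then show U: "?U \<in> fmeasurable lborel"
    using cov W by (intro fmeasurableI2[OF W]) auto
  have "measure lborel ?U \<le> measure lborel (\<Union>i\<in>C. ball (fst i) (5 * snd i))"
    using cov U W
    by (intro measure_mono_fmeasurable) auto
  with m show "measure lborel ?U \<le> V" by simp
qed

section \<open>Cubes and a Poincare inequality for piecewise constant functions\<close>

text \<open>A pair consists of a lower corner and a side length. The cubes are half-open, so that a cube is a
disjoint union of its dyadic subcubes.\<close>

definition cube :: "(real^'n) \<times> real \<Rightarrow> (real^'n) set" where
  "cube p = {x. \<forall>i. fst p $ i \<le> x $ i \<and> x $ i < fst p $ i + snd p}"

lemma cube_borel [measurable]: "cube p \<in> sets borel"
  unfolding cube_def by measurable

lemma measure_cbox_cart: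
  fixes a b :: "real^'n"
  assumes "\<And>i. a $ i \<le> b $ i"
  shows "measure lborel (cbox a b) = (\<Prod>i\<in>UNIV. b $ i - a $ i)"
proof -
  have "cbox a b \<noteq> {}" using assms by (simp add: interval_ne_empty_cart)
  then show ?thesis by (rule content_cbox_cart)
qed

lemma emeasure_cube:
  fixes p :: "(real^'n) \<times> real"
  assumes "0 \<le> snd p"
  shows "emeasure lborel (cube p) = ennreal (snd p ^ CARD('n))"
proof -
  define b where "b = (\<chi> i. fst p $ i + snd p)"
  have c: "measure lborel (cbox (fst p) b) = snd p ^ CARD('n)"
    by (subst measure_cbox_cart) (use assms in \<open>auto simp: b_def\<close>)
  have "emeasure lborel (cube p) \<le> emeasure lborel (cbox (fst p) b)"
    by (rule emeasure_mono) (auto simp: cube_def mem_box_cart b_def less_imp_le)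
  moreover have "emeasure lborel (box (fst p) b) \<le> emeasure lborel (cube p)"
    by (rule emeasure_mono) (auto simp: cube_def mem_box_cart b_def less_imp_le)
  moreover have "emeasure lborel (box (fst p) b) = emeasure lborel (cbox (fst p) b)"
    by (simp add: emeasure_lborel_box_eq emeasure_lborel_cbox_eq)
  ultimately have "emeasure lborel (cube p) = emeasure lborel (cbox (fst p) b)" by simp
  also have "\<dots> = ennreal (measure lborel (cbox (fst p) b))"
    using emeasure_lborel_cbox_finite[of "fst p" b] by (intro emeasure_eq_ennreal_measure) simp
  finally show ?thesis by (simp add: c)
qed

lemma fmeasurable_cube [simp]: 
  fixes p :: "(real^'n) \<times> real"
  assumes "0 \<le> snd p"
  shows "cube p \<in> fmeasurable lborel"
  using emeasure_cube[OF assms] by (auto simp: fmeasurable_def)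

lemma measure_cube:
  fixes p :: "(real^'n) \<times> real"
  assumes "0 \<le> snd p"
  shows "measure lborel (cube p) = snd p ^ CARD('n)"
  using emeasure_cube[OF assms] assms by (simp add: measure_def)

text \<open>A point that leaves the cube under translation by \<open>v\<close> does so through one of the faces, hence lies in
one of the slabs of thickness \<open>\<bar>v $ i\<bar>\<close> along these faces.\<close>

lemma emeasure_cube_exit:
  fixes p :: "(real^'n) \<times> real" and v :: "real^'n"
  assumes s: "0 \<le> snd p"
  shows "emeasure lborel {x \<in> cube p. x + v \<notin> cube p}
           \<le> ennreal ((\<Sum>i\<in>UNIV. \<bar>v $ i\<bar>) * snd p ^ (CARD('n) - 1))"
proof -
  define lo where "lo j = (\<chi> i. if i = j \<and> 0 \<le> v $ j then fst p $ i + snd p - v $ j else fst p $ i)" for j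
  define hi where "hi j = (\<chi> i. if i = j \<and> v $ j < 0 then fst p $ i - v $ j else fst p $ i + snd p)" for j
  have m: "emeasure lborel (cbox (lo j) (hi j)) = ennreal (\<bar>v $ j\<bar> * snd p ^ (CARD('n) - 1))" for j
  proof -
    have "measure lborel (cbox (lo j) (hi j)) = (\<Prod>i\<in>UNIV. hi j $ i - lo j $ i)"
      by (rule measure_cbox_cart) (use s in \<open>auto simp: lo_def hi_def\<close>)
    also have "\<dots> = (hi j $ j - lo j $ j) * (\<Prod>i\<in>UNIV - {j}. hi j $ i - lo j $ i)"
      by (rule prod.remove) auto
    also have "(\<Prod>i\<in>UNIV - {j}. hi j $ i - lo j $ i) = (\<Prod>i\<in>UNIV - {j}. snd p)"
      by (rule prod.cong) (auto simp: hi_def lo_def)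
    also have "\<dots> = snd p ^ (CARD('n) - 1)"
      by (simp add: card_Diff_singleton)
    also have "hi j $ j - lo j $ j = \<bar>v $ j\<bar>" by (auto simp: hi_def lo_def)
    finally show ?thesis
      using emeasure_lborel_cbox_finite[of "lo j" "hi j"] by (subst emeasure_eq_ennreal_measure) auto
  qed
  have "emeasure lborel {x \<in> cube p. x + v \<notin> cube p} \<le> emeasure lborel (\<Union>j\<in>UNIV. cbox (lo j) (hi j))"
  proof (rule emeasure_mono)
    show "{x \<in> cube p. x + v \<notin> cube p} \<subseteq> (\<Union>j\<in>UNIV. cbox (lo j) (hi j))"
    proof
      fix x assume x: "x \<in> {x \<in> cube p. x + v \<notin> cube p}"
      then obtain j where j: "\<not> (fst p $ j \<le> x $ j + v $ j \<and> x $ j + v $ j < fst p $ j + snd p)"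
        by (auto simp: cube_def)
      have b: "fst p $ i \<le> x $ i" "x $ i < fst p $ i + snd p" for i using x by (auto simp: cube_def)
      have "x \<in> cbox (lo j) (hi j)"
        unfolding mem_box_cart
      proof
        fix i show "lo j $ i \<le> x $ i \<and> x $ i \<le> hi j $ i"
          using b[of i] j b[of j] by (auto simp: lo_def hi_def)
      qed
      then show "x \<in> (\<Union>j\<in>UNIV. cbox (lo j) (hi j))" by blast
    qed
  qed auto
  also have "\<dots> \<le> (\<Sum>j\<in>UNIV. emeasure lborel (cbox (lo j) (hi j)))"
    by (rule emeasure_subadditive_finite) auto
  also have "\<dots> = ennreal ((\<Sum>i\<in>UNIV. \<bar>v $ i\<bar>) * snd p ^ (CARD('n) - 1))"
    using s by (simp add: m sum_distrib_right sum_ennreal)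
  finally show ?thesis .
qed

lemma nn_integral_lborel_shift:
  fixes g :: "'a::euclidean_space \<Rightarrow> ennreal"
  assumes [measurable]: "g \<in> borel_measurable borel"
  shows "(\<integral>\<^sup>+x. g (x + a) \<partial>lborel) = (\<integral>\<^sup>+x. g x \<partial>lborel)"
proof -
  have "(\<integral>\<^sup>+x. g x \<partial>lborel) = (\<integral>\<^sup>+x. g x \<partial>distr lborel borel ((+) a))"
    by (simp add: lborel_distr_plus)
  also have "\<dots> = (\<integral>\<^sup>+x. g (a + x) \<partial>lborel)"
    by (subst nn_integral_distr) auto
  finally show ?thesis by (simp add: add.commute)
qed

lemma cube_convex: "convex (cube p)"
proof -
  have "cube p = (\<Inter>i. {x. fst p $ i \<le> x $ i} \<inter> {x. x $ i < fst p $ i + snd p})"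
    by (auto simp: cube_def)
  moreover have "convex {x::real^'n. c \<le> x $ i}" "convex {x::real^'n. x $ i < c}" for c i
    using convex_halfspace_ge[of c "axis i 1 :: real^'n"] convex_halfspace_lt[of "axis i 1 :: real^'n" c]
    by (simp_all add: cart_eq_inner_axis inner_commute)
  ultimately show ?thesis by (simp only:) (intro convex_INT convex_Int)
qed

text \<open>For a function of bounded variation, the mean of \<open>\<bar>u (x + v) - u x\<bar>\<close> over a convex set is at most
\<open>\<bar>v\<bar>\<close> times the total variation. Here \<open>u\<close> jumps only when a point crosses the boundary of a cube of
\<open>P\<close>, by at most \<open>c p\<close>, so the variation is bounded by the sum of \<open>c p\<close> times the area of the boundary of
\<open>p\<close>. The estimate is read off for short \<open>v\<close> from the volume of the boundary layers; it extends to all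
\<open>v\<close> because a long translation is a composition of short ones and the measure is translation
invariant; integrating over \<open>v\<close> gives the mean oscillation.\<close>

lemma piecewise_constant_poincare:
  fixes q :: "(real^'n) \<times> real" and u :: "real^'n \<Rightarrow> real^'m" and P :: "((real^'n) \<times> real) set"
  assumes fin: "finite P" and side: "\<And>p. p \<in> P \<Longrightarrow> 0 \<le> snd p" and c: "\<And>p. p \<in> P \<Longrightarrow> 0 \<le> c p"
    and u [measurable]: "u \<in> borel_measurable borel" and l: "0 < snd q" and r: "0 < r"
    and jump: "\<And>x y. x \<in> cube q \<Longrightarrow> y \<in> cube q \<Longrightarrow> dist x y \<le> r \<Longrightarrow>
       u x = u y \<or> (\<exists>p\<in>P. dist (u x) (u y) \<le> c p \<and> (x \<in> cube p \<longleftrightarrow> y \<notin> cube p))"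
  shows "(\<integral>\<^sup>+x. \<integral>\<^sup>+y. ennreal (dist (u x) (u y)) * indicator (cube q \<times> cube q) (x, y) \<partial>lborel \<partial>lborel)
     \<le> ennreal (2 ^ (CARD('n) + 1) * CARD('n) * snd q ^ (CARD('n) + 1) * (\<Sum>p\<in>P. c p * snd p ^ (CARD('n) - 1)))"
proof -
  let ?d = "CARD('n)"
  define G where "G x y = ennreal (dist (u x) (u y)) * indicator (cube q \<times> cube q) (x, y)" for x y
  have Gm [measurable]: "(\<lambda>(x, y). G x y) \<in> borel_measurable (borel \<Otimes>\<^sub>M borel)"
    unfolding G_def by measurable
  have Gm' [measurable (raw)]: "g \<in> borel_measurable M \<Longrightarrow> h \<in> borel_measurable M \<Longrightarrow> (\<lambda>x. G (g x) (h x)) \<in> borel_measurable M"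
    for g h :: "'z \<Rightarrow> real^'n" and M
    using measurable_compose[OF measurable_Pair Gm, of g M h] by simp
  \<comment> \<open>\<open>F v\<close> is the integral of \<open>\<bar>u (x + v) - u x\<bar>\<close> over the points that stay in the cube.\<close>
  define F where "F v = (\<integral>\<^sup>+x. G x (x + v) \<partial>lborel)" for v
  define K where "K = (\<Sum>p\<in>P. c p * snd p ^ (?d - 1))"
  have K0: "0 \<le> K" unfolding K_def by (intro sum_nonneg mult_nonneg_nonneg zero_le_power c side)
  define N where "N v = (\<Sum>i\<in>UNIV. \<bar>v $ i\<bar>)" for v :: "real^'n"
  have N0: "0 \<le> N v" for v unfolding N_def by (intro sum_nonneg) auto
  have small: "F v \<le> ennreal (2 * N v * K)" if v: "norm v \<le> r" for v
  proof -
    define A where "A p = {x \<in> cube p. x + v \<notin> cube p}" for p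
    define B where "B p = {x. x \<notin> cube p \<and> x + v \<in> cube p}" for p
    have [measurable]: "A p \<in> sets borel" "B p \<in> sets borel" for p
      unfolding A_def B_def by measurable
    have pt: "G x (x + v) \<le> (\<Sum>p\<in>P. ennreal (c p) * (indicator (A p) x + indicator (B p) x))" for x
    proof (cases "x \<in> cube q \<and> x + v \<in> cube q \<and> u x \<noteq> u (x + v)")
      case True
      then obtain p where p: "p \<in> P" "dist (u x) (u (x + v)) \<le> c p" "x \<in> cube p \<longleftrightarrow> x + v \<notin> cube p"
        using jump[of x "x + v"] v by (auto simp: dist_norm)
      have "G x (x + v) \<le> ennreal (c p) * (indicator (A p) x + indicator (B p) x)"
        using p True by (auto simp: G_def A_def B_def indicator_def ennreal_leI)
      also have "\<dots> \<le> (\<Sum>p\<in>P. ennreal (c p) * (indicator (A p) x + indicator (B p) x))"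
        by (rule member_le_sum) (use p fin in auto)
      finally show ?thesis .
    next
      case False
      then have "G x (x + v) = 0" by (auto simp: G_def indicator_def)
      then show ?thesis by simp
    qed
    have A: "emeasure lborel (A p) \<le> ennreal (N v * snd p ^ (?d - 1))" if "p \<in> P" for p
      unfolding A_def N_def by (rule emeasure_cube_exit[OF side[OF that]])
    have B: "emeasure lborel (B p) \<le> ennreal (N v * snd p ^ (?d - 1))" if "p \<in> P" for p
    proof -
      have "emeasure lborel (B p) = (\<integral>\<^sup>+x. indicator {y \<in> cube p. y + (- v) \<notin> cube p} (x + v) \<partial>lborel)"
      proof -
        have "indicator (B p) x = (indicator {y \<in> cube p. y + (- v) \<notin> cube p} (x + v) :: ennreal)" for x
          by (simp add: B_def indicator_def conj_commute)
        then show ?thesis using nn_integral_indicator[of "B p" lborel] by simp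
      qed
      also have "\<dots> = emeasure lborel {y \<in> cube p. y + (- v) \<notin> cube p}"
        by (subst nn_integral_lborel_shift) auto
      also have "\<dots> \<le> ennreal (N v * snd p ^ (?d - 1))"
        using emeasure_cube_exit[OF side[OF that], of "- v"] by (simp add: N_def)
      finally show ?thesis .
    qed
    have "F v \<le> (\<integral>\<^sup>+x. (\<Sum>p\<in>P. ennreal (c p) * (indicator (A p) x + indicator (B p) x)) \<partial>lborel)"
      unfolding F_def by (rule nn_integral_mono) (rule pt)
    also have "\<dots> = (\<Sum>p\<in>P. ennreal (c p) * (emeasure lborel (A p) + emeasure lborel (B p)))"
      by (simp add: nn_integral_sum nn_integral_cmult nn_integral_add)
    also have "\<dots> \<le> (\<Sum>p\<in>P. ennreal (c p) * (ennreal (N v * snd p ^ (?d - 1)) + ennreal (N v * snd p ^ (?d - 1))))"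
      by (intro sum_mono mult_left_mono add_mono A B) auto
    also have "\<dots> = (\<Sum>p\<in>P. ennreal (c p * (2 * N v * snd p ^ (?d - 1))))"
      by (intro sum.cong) (auto simp: c side N0 ennreal_plus[symmetric] ennreal_mult[symmetric] simp del: ennreal_plus)
    also have "\<dots> = ennreal (\<Sum>p\<in>P. c p * (2 * N v * snd p ^ (?d - 1)))"
      by (rule sum_ennreal) (auto simp: c side N0)
    also have "(\<Sum>p\<in>P. c p * (2 * N v * snd p ^ (?d - 1))) = 2 * N v * K"
      unfolding K_def by (simp add: sum_distrib_left mult_ac)
    finally show ?thesis .
  qed
  have chain: "F (real n *\<^sub>R w) \<le> of_nat n * F w" for n w
  proof (induction n)
    case 0
    have "G x x = 0" for x by (simp add: G_def)
    then show ?case by (simp add: F_def)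
  next
    case (Suc n)
    have pt: "G x (x + real (Suc n) *\<^sub>R w) \<le> G x (x + real n *\<^sub>R w) + G (x + real n *\<^sub>R w) (x + real n *\<^sub>R w + w)" for x
    proof (cases "x \<in> cube q \<and> x + real (Suc n) *\<^sub>R w \<in> cube q")
      case True
      let ?y = "x + real n *\<^sub>R w" and ?z = "x + real (Suc n) *\<^sub>R w"
      have eq: "?y + w = ?z" by (simp add: algebra_simps)
      have "(1 - real n / real (Suc n)) *\<^sub>R x + (real n / real (Suc n)) *\<^sub>R ?z \<in> cube q"
        by (rule convexD_alt[OF cube_convex]) (use True in auto)
      also have "(1 - real n / real (Suc n)) *\<^sub>R x + (real n / real (Suc n)) *\<^sub>R ?z = ?y"
        by (simp add: algebra_simps del: of_nat_Suc)
      finally have y: "?y \<in> cube q" .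
      have "ennreal (dist (u x) (u ?z)) \<le> ennreal (dist (u x) (u ?y)) + ennreal (dist (u ?y) (u ?z))"
        using ennreal_leI[OF dist_triangle[of "u x" "u ?z" "u ?y"]] by (simp only: ennreal_plus zero_le_dist)
      then show ?thesis unfolding eq G_def using True y by simp
    qed (auto simp: G_def)
    have "F (real (Suc n) *\<^sub>R w) \<le> (\<integral>\<^sup>+x. G x (x + real n *\<^sub>R w) + G (x + real n *\<^sub>R w) (x + real n *\<^sub>R w + w) \<partial>lborel)"
      unfolding F_def by (rule nn_integral_mono) (rule pt)
    also have "\<dots> = F (real n *\<^sub>R w) + (\<integral>\<^sup>+x. G (x + real n *\<^sub>R w) (x + real n *\<^sub>R w + w) \<partial>lborel)"
      unfolding F_def by (rule nn_integral_add) auto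
    also have "(\<integral>\<^sup>+x. G (x + real n *\<^sub>R w) (x + real n *\<^sub>R w + w) \<partial>lborel) = F w"
      unfolding F_def by (rule nn_integral_lborel_shift[of "\<lambda>x. G x (x + w)"]) auto
    also have "F (real n *\<^sub>R w) + F w \<le> of_nat n * F w + F w" by (intro add_right_mono Suc)
    finally show ?case by (simp add: algebra_simps)
  qed
  have all: "F v \<le> ennreal (2 * N v * K)" for v
  proof -
    obtain n :: nat where n: "norm v / r < real n" "0 < n"
      by (metis reals_Archimedean2 gr0I less_le_trans not_less of_nat_0 order_less_trans norm_ge_zero r divide_nonneg_pos)
    define w where "w = (1 / real n) *\<^sub>R v"
    have v: "v = real n *\<^sub>R w" using n by (simp add: w_def)
    have "norm w \<le> r" using n r by (simp add: w_def divide_simps mult.commute)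
    then have "F v \<le> of_nat n * ennreal (2 * N w * K)"
      unfolding v by (intro order_trans[OF chain] mult_left_mono small) auto
    also have "\<dots> = ennreal (real n * (2 * N w * K))"
      using N0 K0 by (simp add: ennreal_mult ennreal_of_nat_eq_real_of_nat)
    also have "real n * (2 * N w * K) = 2 * N v * K"
      unfolding v by (simp add: N_def abs_mult sum_distrib_left mult_ac)
    finally show ?thesis .
  qed
  define b :: "real^'n" where "b = (\<chi> i. snd q)"
  have bound: "F v \<le> ennreal (2 * ?d * snd q * K) * indicator (cbox (- b) b) v" for v
  proof (cases "\<exists>x. x \<in> cube q \<and> x + v \<in> cube q")
    case True
    then obtain x where x: "x \<in> cube q" "x + v \<in> cube q" by blast
    have vi: "\<bar>v $ i\<bar> \<le> snd q" for i
      using x by (auto simp: cube_def dest!: spec[of _ i])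
    then have "v \<in> cbox (- b) b" by (auto simp: mem_box_cart b_def abs_le_iff minus_le_iff)
    moreover have "N v \<le> ?d * snd q" 
      unfolding N_def using sum_bounded_above[of UNIV "\<lambda>i. \<bar>v $ i\<bar>" "snd q"] vi by simp
    then have "2 * N v * K \<le> 2 * ?d * snd q * K"
      using K0 by (intro mult_right_mono) auto
    ultimately show ?thesis using order_trans[OF all[of v] ennreal_leI] by simp
  next
    case False
    then have "G x (x + v) = 0" for x by (auto simp: G_def indicator_def)
    then show ?thesis by (simp add: F_def)
  qed
  have "(\<integral>\<^sup>+x. \<integral>\<^sup>+y. G x y \<partial>lborel \<partial>lborel) = (\<integral>\<^sup>+x. \<integral>\<^sup>+v. G x (x + v) \<partial>lborel \<partial>lborel)"
  proof (rule nn_integral_cong)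
    fix x show "(\<integral>\<^sup>+y. G x y \<partial>lborel) = (\<integral>\<^sup>+v. G x (x + v) \<partial>lborel)"
      using nn_integral_lborel_shift[of "G x" x] by (simp add: add.commute)
  qed
  also have "\<dots> = (\<integral>\<^sup>+v. F v \<partial>lborel)"
    unfolding F_def by (rule lborel_pair.Fubini'[symmetric]) simp
  also have "\<dots> \<le> (\<integral>\<^sup>+v. ennreal (2 * ?d * snd q * K) * indicator (cbox (- b) b) v \<partial>lborel)"
    by (rule nn_integral_mono) (rule bound)
  also have "\<dots> = ennreal (2 * ?d * snd q * K) * emeasure lborel (cbox (- b) b)"
    by (subst nn_integral_cmult) auto
  also have "emeasure lborel (cbox (- b) b) = ennreal (measure lborel (cbox (- b) b))"
    using emeasure_lborel_cbox_finite[of "- b" b] by (intro emeasure_eq_ennreal_measure) simp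
  also have "measure lborel (cbox (- b) b) = (2 * snd q) ^ ?d"
    by (subst measure_cbox_cart) (use l in \<open>auto simp: b_def\<close>)
  also have "ennreal (2 * ?d * snd q * K) * ennreal ((2 * snd q) ^ ?d) =
     ennreal (2 ^ (?d + 1) * ?d * snd q ^ (?d + 1) * K)"
    using l K0 by (subst ennreal_mult[symmetric]) (auto simp: power_mult_distrib mult_ac)
  finally show ?thesis unfolding G_def K_def .
qed

section \<open>Flat cubes cannot fill a cube\<close>

lemma dist_le_CARD:
  fixes x y :: "real^'n" and s :: real
  assumes "\<And>i. \<bar>x $ i - y $ i\<bar> \<le> s"
  shows "dist x y \<le> CARD('n) * s"
proof -
  have "dist x y \<le> (\<Sum>i\<in>UNIV. \<bar>(x - y) $ i\<bar>)" unfolding dist_norm by (rule norm_le_l1_cart)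
  also have "\<dots> \<le> (\<Sum>i\<in>(UNIV::'n set). s)" by (rule sum_mono) (use assms in simp)
  finally show ?thesis by simp
qed

lemma dist_in_cube:
  fixes x y :: "real^'n" and p :: "(real^'n) \<times> real"
  assumes "x \<in> cube p" "y \<in> cube p"
  shows "dist x y \<le> CARD('n) * snd p"
proof (rule dist_le_CARD)
  fix i show "\<bar>x $ i - y $ i\<bar> \<le> snd p"
    using assms by (auto simp: cube_def abs_le_iff dest!: spec[of _ i])
qed

text \<open>Otherwise the trace of \<open>E\<close> on the cube would fit into a ball of too small a volume.\<close>

lemma thick_imp_separated_points:
  fixes p :: "(real^'n) \<times> real"
  assumes "0 < snd p" "unit_ball_vol (CARD('n)) * \<beta> ^ CARD('n) < \<tau>" "0 < \<beta>"
    and "\<tau> * snd p ^ CARD('n) \<le> measure lborel (E \<inter> cube p)"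
  shows "\<exists>y\<in>E \<inter> cube p. \<exists>z\<in>E \<inter> cube p. \<beta> * snd p \<le> dist y z"
proof (rule ccontr)
  assume neg: "\<not> ?thesis"
  let ?V = "unit_ball_vol (real CARD('n)) * (\<beta> * snd p) ^ CARD('n)"
  have "?V = unit_ball_vol (CARD('n)) * \<beta> ^ CARD('n) * snd p ^ CARD('n)"
    by (simp add: power_mult_distrib)
  also have "\<dots> < \<tau> * snd p ^ CARD('n)"
    using assms by (intro mult_strict_right_mono) auto
  finally have less: "?V < measure lborel (E \<inter> cube p)" using assms by simp
  moreover have "0 \<le> ?V" using assms by (intro mult_nonneg_nonneg) auto
  ultimately have "E \<inter> cube p \<noteq> {}" by auto
  then obtain y where y: "y \<in> E \<inter> cube p" by blast
  have "E \<inter> cube p \<subseteq> ball y (\<beta> * snd p)"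
    using neg y by (auto simp: not_le)
  then have "measure lborel (E \<inter> cube p) \<le> measure lborel (ball y (\<beta> * snd p))"
    by (cases "E \<inter> cube p \<in> sets lborel")
       (auto intro!: measure_mono_fmeasurable fmeasurable_ball simp: measure_notin_sets)
  also have "\<dots> = ?V" using assms by (simp add: content_ball)
  finally show False using less by simp
qed

text \<open>A discrete layer-cake formula: above the level \<open>m\<close>, the number \<open>g\<close> is dominated by the sum of the
dyadic levels below it.\<close>

lemma dyadic_layer_bound:
  fixes g m :: real
  assumes "0 < m" "g \<le> m * 2 ^ J"
  shows "g \<le> m + (\<Sum>j<J. if m * 2 ^ j < g then m * 2 ^ j else 0)"
  using assms(2)
proof (induction J)
  case (Suc J)
  show ?case
  proof (cases "g \<le> m * 2 ^ J")
    case True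
    with Suc.IH show ?thesis by simp
  next
    case False
    have "m * 2 ^ j < g" if "j < Suc J" for j
    proof -
      have "m * 2 ^ j \<le> m * 2 ^ J" using that assms(1) by (intro mult_left_mono power_increasing) auto
      with False show ?thesis by simp
    qed
    then have "(\<Sum>j<Suc J. if m * 2 ^ j < g then m * 2 ^ j else 0) = (\<Sum>j<Suc J. m * 2 ^ j)"
      by (intro sum.cong) auto
    also have "\<dots> = m * 2 ^ Suc J - m"
      by (simp only: sum_distrib_left[symmetric] sum_gp_strict) (simp add: algebra_simps)
    finally show ?thesis using Suc.prems by simp
  qed
qed simp

lemma disjoint_cubes_sum:
  fixes P :: "((real^'n) \<times> real) set"
  assumes "finite P" "\<And>p. p \<in> P \<Longrightarrow> 0 < snd p" "pairwise (\<lambda>p p'. disjnt (cube p) (cube p')) P"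
  shows "(\<Sum>p\<in>P. snd p ^ CARD('n)) = measure lborel (\<Union>p\<in>P. cube p)"
proof -
  have "measure lborel (\<Union>p\<in>P. cube p) = (\<Sum>p\<in>P. measure lborel (cube p))"
  proof (rule measure_finite_Union)
    show "disjoint_family_on cube P"
      using assms(3) unfolding disjoint_family_on_def pairwise_def disjnt_def by blast
    show "emeasure lborel (cube p) \<noteq> \<infinity>" if "p \<in> P" for p
      using emeasure_cube[of p] assms(2)[OF that] by simp
  qed (use assms in auto)
  also have "\<dots> = (\<Sum>p\<in>P. snd p ^ CARD('n))"
    by (intro sum.cong) (auto simp: measure_cube assms(2) less_imp_le)
  finally show ?thesis by simp
qed

text \<open>The weak-type estimate for cubes. A cube of the family need not meet \<open>E\<close>; it is only required that
some point of \<open>E\<close> lies at a distance comparable to its side.\<close>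

lemma steep_cubes_bound:
  fixes f :: "real^'n \<Rightarrow> real^'n" and P :: "((real^'n) \<times> real) set" and A :: real
  assumes d: "distortion H E f" and bd: "bounded (f ` E)" and k: "0 < \<kappa>" and A: "2 * real CARD('n) < A"
    and P: "finite P" "\<And>p. p \<in> P \<Longrightarrow> 0 < snd p" "pairwise (\<lambda>p p'. disjnt (cube p) (cube p')) P"
    and rep: "\<And>p. p \<in> P \<Longrightarrow> rep p \<in> E" "\<And>p x. p \<in> P \<Longrightarrow> x \<in> cube p \<Longrightarrow> dist x (rep p) \<le> 2 * real CARD('n) * snd p"
    and steep: "\<And>p. p \<in> P \<Longrightarrow> \<kappa> * snd p < diameter (f ` (E \<inter> ball (rep p) (A * snd p)))"
  shows "(\<Sum>p\<in>P. snd p ^ CARD('n)) \<le> unit_ball_vol (CARD('n)) * (40 * H 1 * A) ^ CARD('n) * (diameter (f ` E) / \<kappa>) ^ CARD('n)"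
proof -
  have A0: "0 < A" using A by (simp add: le_less_trans[OF _ A])
  define K where "K = (\<lambda>p. (rep p, A * snd p)) ` P"
  define B where "B = Max (insert 0 ((\<lambda>p. A * snd p) ` P))"
  have K: "x \<in> E \<and> 0 < r \<and> r \<le> B \<and> \<kappa> / A * r < diameter (f ` (E \<inter> ball x r))" if xr: "(x, r) \<in> K" for x r
  proof -
    obtain p where p: "p \<in> P" "x = rep p" "r = A * snd p" using xr unfolding K_def by auto
    have "r \<le> B" unfolding B_def p(3) using P p(1) by (intro Max_ge) auto
    then show ?thesis using p rep(1)[of p] P(2)[of p] A0 steep[of p] by simp
  qed
  note W = weak_type_estimate[OF d bd _ K, simplified]
  have "(\<Sum>p\<in>P. snd p ^ CARD('n)) = measure lborel (\<Union>p\<in>P. cube p)"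
    by (rule disjoint_cubes_sum[OF P])
  also have "\<dots> \<le> measure lborel (\<Union>(x,r)\<in>K. ball x r)"
  proof (rule measure_mono_fmeasurable)
    show "(\<Union>p\<in>P. cube p) \<subseteq> (\<Union>(x,r)\<in>K. ball x r)"
    proof
      fix x assume "x \<in> (\<Union>p\<in>P. cube p)"
      then obtain p where p: "p \<in> P" "x \<in> cube p" by blast
      have "2 * real CARD('n) * snd p < A * snd p" using A P(2)[OF p(1)] by (rule mult_strict_right_mono)
      then have "x \<in> ball (rep p) (A * snd p)" using rep(2)[OF p] by (simp add: dist_commute)
      then show "x \<in> (\<Union>(x,r)\<in>K. ball x r)" using p(1) by (auto simp: K_def)
    qed
  qed (use W k A0 in \<open>auto intro!: sets.finite_UN P(1)\<close>)
  also have "\<dots> \<le> unit_ball_vol (CARD('n)) * (40 * H 1 * diameter (f ` E) / (\<kappa> / A)) ^ CARD('n)"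
    using W k A0 by simp
  also have "40 * H 1 * diameter (f ` E) / (\<kappa> / A) = (40 * H 1 * A) * (diameter (f ` E) / \<kappa>)"
    by simp
  finally show ?thesis by (simp only: power_mult_distrib mult.assoc)
qed

text \<open>Summing the weak \<open>(d, d)\<close> inequality over dyadic levels turns it into an \<open>L\<^sup>1\<close> bound for the slope on
a set of small measure. The level \<open>m 2 ^ j\<close> contributes a multiple of \<open>(2 ^ j) powr (1 - d)\<close>, and this
is where \<open>d \<ge> 2\<close> is indispensable: for \<open>d = 1\<close> the series diverges, and there are quasisymmetric maps
of the line that are singular.\<close>

lemma gap_cubes_sum:
  fixes f :: "real^'n \<Rightarrow> real^'n" and P :: "((real^'n) \<times> real) set" and A :: real
  assumes d: "distortion H E f" and bd: "bounded (f ` E)" and m: "0 < m" and A: "2 * real CARD('n) < A"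
    and n: "2 \<le> CARD('n)"
    and P: "finite P" "\<And>p. p \<in> P \<Longrightarrow> 0 < snd p" "pairwise (\<lambda>p p'. disjnt (cube p) (cube p')) P"
    and rep: "\<And>p. p \<in> P \<Longrightarrow> rep p \<in> E" "\<And>p x. p \<in> P \<Longrightarrow> x \<in> cube p \<Longrightarrow> dist x (rep p) \<le> 2 * real CARD('n) * snd p"
  shows "(\<Sum>p\<in>P. diameter (f ` (E \<inter> ball (rep p) (A * snd p))) * snd p ^ (CARD('n) - 1))
     \<le> m * (\<Sum>p\<in>P. snd p ^ CARD('n)) 
       + 2 * m * (unit_ball_vol (CARD('n)) * (40 * H 1 * A) ^ CARD('n) * (diameter (f ` E) / m) ^ CARD('n))"
proof -
  let ?d = "CARD('n)"
  define c :: "(real^'n) \<times> real \<Rightarrow> real" where "c p = diameter (f ` (E \<inter> ball (rep p) (A * snd p)))" for p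
  define V where "V = unit_ball_vol (real ?d) * (40 * H 1 * A) ^ ?d"
  define D where "D = diameter (f ` E)"
  define g :: "(real^'n) \<times> real \<Rightarrow> real" where "g p = c p / snd p" for p
  have A0: "0 < A" using A by (simp add: le_less_trans[OF _ A])
  have V0: "0 \<le> V" unfolding V_def using A0 distortion_ge_1[OF d, of 1] by (intro mult_nonneg_nonneg zero_le_power) auto
  have D0: "0 \<le> D" unfolding D_def by (rule diameter_ge_0[OF bd])
  define Gm where "Gm = Max (insert 0 (g ` P))"
  have gle: "g p \<le> Gm" if "p \<in> P" for p unfolding Gm_def using P(1) that by (intro Max_ge) auto
  obtain J where J: "Gm / m < 2 ^ J" using real_arch_pow[of 2 "Gm / m"] by auto
  have gJ: "g p \<le> m * 2 ^ J" if "p \<in> P" for p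
    using gle[OF that] J m by (simp add: pos_divide_less_eq mult.commute)
  have layer: "(\<Sum>p | p \<in> P \<and> m * 2 ^ j < g p. snd p ^ ?d) \<le> V * (D / (m * 2 ^ j)) ^ ?d" for j
    unfolding V_def D_def
  proof (rule steep_cubes_bound[OF d bd _ A])
    show "pairwise (\<lambda>p p'. disjnt (cube p) (cube p')) {p \<in> P. m * 2 ^ j < g p}"
      by (rule pairwise_subset[OF P(3)]) auto
    show "m * 2 ^ j * snd p < diameter (f ` (E \<inter> ball (rep p) (A * snd p)))" if "p \<in> {p \<in> P. m * 2 ^ j < g p}" for p
      using that P(2)[of p] by (auto simp: g_def c_def pos_less_divide_eq)
  qed (use m P rep in auto)
  have lay': "m * 2 ^ j * (V * (D / (m * 2 ^ j)) ^ ?d) \<le> m * (V * (D / m) ^ ?d) * (1 / 2) ^ j" for j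
  proof -
    have "2 ^ j * ((1::real) / 2 ^ j) ^ ?d \<le> 2 ^ j * (1 / 2 ^ j) ^ 2"
      by (intro mult_left_mono power_decreasing n) auto
    also have "\<dots> = (1 / 2) ^ j" by (simp add: power2_eq_square power_one_over)
    finally have *: "2 ^ j * ((1::real) / 2 ^ j) ^ ?d \<le> (1 / 2) ^ j" .
    have "m * 2 ^ j * (V * (D / (m * 2 ^ j)) ^ ?d) = m * (V * (D / m) ^ ?d) * (2 ^ j * ((1::real) / 2 ^ j) ^ ?d)"
      by (simp add: power_mult_distrib power_divide)
    also have "\<dots> \<le> m * (V * (D / m) ^ ?d) * (1 / 2) ^ j"
      using m V0 D0 by (intro mult_left_mono *) auto
    finally show ?thesis .
  qed
  have "(\<Sum>p\<in>P. c p * snd p ^ (?d - 1)) = (\<Sum>p\<in>P. g p * snd p ^ ?d)"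
  proof (rule sum.cong)
    fix p assume "p \<in> P"
    then have "0 < snd p" using P by blast
    moreover have "snd p ^ ?d = snd p ^ (?d - 1) * snd p" using n by (simp add: power_eq_if mult.commute)
    ultimately show "c p * snd p ^ (?d - 1) = g p * snd p ^ ?d" by (simp add: g_def)
  qed simp
  also have "\<dots> \<le> (\<Sum>p\<in>P. (m + (\<Sum>j<J. if m * 2 ^ j < g p then m * 2 ^ j else 0)) * snd p ^ ?d)"
    by (intro sum_mono mult_right_mono dyadic_layer_bound m gJ) (auto simp: P less_imp_le)
  also have "\<dots> = m * (\<Sum>p\<in>P. snd p ^ ?d) + (\<Sum>p\<in>P. \<Sum>j<J. (if m * 2 ^ j < g p then m * 2 ^ j * snd p ^ ?d else 0))"
    by (simp add: distrib_right sum.distrib sum_distrib_left sum_distrib_right if_distrib[of "\<lambda>x. x * _"] cong: if_cong)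
  also have "(\<Sum>p\<in>P. \<Sum>j<J. (if m * 2 ^ j < g p then m * 2 ^ j * snd p ^ ?d else 0))
     = (\<Sum>j<J. \<Sum>p\<in>P. (if m * 2 ^ j < g p then m * 2 ^ j * snd p ^ ?d else 0))"
    by (rule sum.swap)
  also have "\<dots> = (\<Sum>j<J. m * 2 ^ j * (\<Sum>p | p \<in> P \<and> m * 2 ^ j < g p. snd p ^ ?d))"
    using P(1) by (auto simp: sum.inter_filter sum_distrib_left intro!: sum.cong)
  also have "\<dots> \<le> (\<Sum>j<J. m * 2 ^ j * (V * (D / (m * 2 ^ j)) ^ ?d))"
    using m by (intro sum_mono mult_left_mono layer) auto
  also have "\<dots> \<le> (\<Sum>j<J. m * (V * (D / m) ^ ?d) * (1 / 2) ^ j)"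
    by (intro sum_mono lay')
  also have "\<dots> = m * (V * (D / m) ^ ?d) * (\<Sum>j<J. (1 / 2) ^ j)" by (simp add: sum_distrib_left)
  also have "\<dots> \<le> m * (V * (D / m) ^ ?d) * 2"
    using m V0 D0 by (intro mult_left_mono) (auto simp: sum_gp_strict)
  finally show ?thesis by (simp add: c_def V_def D_def mult_ac)
qed

text \<open>On a cube where \<open>E\<close> is thick, \<open>E\<close> has two points \<open>y\<close> and \<open>z\<close> whose distance is comparable to the side;
every point of \<open>E\<close> in a neighbourhood of comparable size is then controlled by the pair.\<close>

lemma thick_neighbourhood_diameter:
  fixes f :: "real^'n \<Rightarrow> 'b::metric_space" and p :: "(real^'n) \<times> real"
  assumes d: "distortion H E f" and bd: "bounded (f ` E)"
    and s: "0 < snd p" and b: "0 < \<beta>" and A: "2 * real CARD('n) < A"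
    and yz: "y \<in> E \<inter> cube p" "z \<in> E \<inter> cube p" "\<beta> * snd p \<le> dist y z"
    and rep: "\<And>x. x \<in> cube p \<Longrightarrow> dist x w \<le> 2 * real CARD('n) * snd p"
    and v: "v \<in> E \<inter> ball w (A * snd p)" and v': "v' \<in> E \<inter> ball w (A * snd p)"
  shows "dist (f v) (f v') \<le> 2 * H (2 * A / \<beta>) * diameter (f ` (E \<inter> cube p))"
proof -
  let ?D = "diameter (f ` (E \<inter> cube p))"
  have A0: "0 < A" using A by (simp add: le_less_trans[OF _ A])
  have near: "dist (f y) (f x) \<le> H (2 * A / \<beta>) * ?D" if x: "x \<in> E \<inter> ball w (A * snd p)" for x
  proof -
    have "dist y x \<le> dist y w + dist x w" by (metis dist_commute dist_triangle)
    also have "\<dots> \<le> A * snd p + A * snd p"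
    proof (rule add_mono)
      have "2 * real CARD('n) * snd p \<le> A * snd p" using A s by (intro mult_right_mono) auto
      then show "dist y w \<le> A * snd p" using rep[of y] yz by simp
      show "dist x w \<le> A * snd p" using x by (simp add: dist_commute)
    qed
    also have "\<dots> = 2 * A / \<beta> * (\<beta> * snd p)" using b by simp
    also have "\<dots> \<le> 2 * A / \<beta> * dist y z" using A0 b by (intro mult_left_mono yz) auto
    finally have "dist (f y) (f x) \<le> H (2 * A / \<beta>) * dist (f y) (f z)"
      using yz x A0 b by (intro distortionD[OF d]) auto
    also have "\<dots> \<le> H (2 * A / \<beta>) * ?D"
    proof (rule mult_left_mono)
      show "dist (f y) (f z) \<le> ?D"
        by (rule diameter_bounded_bound) (use yz in \<open>auto intro: bounded_subset[OF bd]\<close>)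
      show "0 \<le> H (2 * A / \<beta>)" using distortion_ge_1[OF d, of "2 * A / \<beta>"] A0 b by simp
    qed
    finally show ?thesis .
  qed
  have "dist (f v) (f v') \<le> dist (f y) (f v) + dist (f y) (f v')" by (metis dist_commute dist_triangle)
  then show ?thesis using near[OF v] near[OF v'] by simp
qed

text \<open>A finite partition of \<open>q\<close> into cubes, each with a nearby representative in \<open>E\<close>. No regularity is
imposed on neighbouring cubes: their sides may be very different.\<close>

definition adapted_partition ::
  "(real^'n) set \<Rightarrow> (real^'n) \<times> real \<Rightarrow> ((real^'n) \<times> real) set \<Rightarrow> ((real^'n) \<times> real \<Rightarrow> real^'n) \<Rightarrow> bool" where
  "adapted_partition E q P rep \<longleftrightarrow>
     finite P \<and> (\<forall>p\<in>P. 0 < snd p \<and> snd p \<le> snd q) \<and>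
     pairwise (\<lambda>p p'. disjnt (cube p) (cube p')) P \<and> (\<Union>p\<in>P. cube p) = cube q \<and>
     (\<forall>p\<in>P. rep p \<in> E \<and> (\<forall>x\<in>cube p. dist x (rep p) \<le> 2 * real CARD('n) * snd p))"

text \<open>The set \<open>E\<close> is \<open>\<tau>\<close>-thick in the cube, and \<open>f\<close> has average slope at most \<open>\<kappa>\<close> there.\<close>

definition flat_cube ::
  "real \<Rightarrow> (real^'n) set \<Rightarrow> (real^'n \<Rightarrow> 'b::metric_space) \<Rightarrow> real \<Rightarrow> (real^'n) \<times> real \<Rightarrow> bool" where
  "flat_cube \<tau> E f \<kappa> p \<longleftrightarrow> \<tau> * snd p ^ CARD('n) \<le> measure lborel (E \<inter> cube p) \<and>
     diameter (f ` (E \<inter> cube p)) \<le> \<kappa> * snd p"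

text \<open>Flat cubes, on which the slope of \<open>f\<close> is \<open>\<epsilon>\<close> times its slope on \<open>q\<close>, leave a fraction \<open>c\<close> of \<open>q\<close>
uncovered. The constants are kept as parameters because they have to be the same for all maps with
the distortion function \<open>H\<close> and at all scales.\<close>

definition flat_cubes_miss :: "(real \<Rightarrow> real) \<Rightarrow> real \<Rightarrow> real \<Rightarrow> real \<Rightarrow> 'n::finite itself \<Rightarrow> bool" where
  "flat_cubes_miss H \<tau> \<epsilon> c (_ :: 'n itself) \<longleftrightarrow>
     (\<forall>(E :: (real^'n) set) (f :: real^'n \<Rightarrow> real^'n) q P S rep.
        distortion H E f \<longrightarrow> bounded (f ` E) \<longrightarrow> E \<in> sets borel \<longrightarrow> 0 < snd q \<longrightarrow> E \<subseteq> cube q \<longrightarrow>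
        0 < diameter (f ` E) \<longrightarrow> \<tau> * snd q ^ CARD('n) \<le> measure lborel E \<longrightarrow>
        adapted_partition E q P rep \<longrightarrow> S \<subseteq> P \<longrightarrow>
        (\<forall>p\<in>S. flat_cube \<tau> E f (\<epsilon> * (diameter (f ` E) / snd q)) p) \<longrightarrow>
        (\<Sum>p\<in>S. snd p ^ CARD('n)) \<le> (1 - c) * snd q ^ CARD('n))"

text \<open>Suppose that the flat cubes \<open>S\<close> cover all but a fraction \<open>c\<close> of \<open>q\<close>. Let \<open>u\<close> be constant on each cube
\<open>p\<close> of the partition, with value \<open>f (rep p)\<close>. Between \<open>p\<close> and a neighbour that is not larger, \<open>u\<close> jumps
by at most the diameter of the image of a neighbourhood of \<open>p\<close>. By the Poincare inequality the
mean oscillation of \<open>u\<close> is bounded by the average of the resulting slopes. It is small: on \<open>S\<close> the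
slopes are small, since \<open>E\<close> is thick there, and off \<open>S\<close> the bound for gap cubes applies to a set of
measure \<open>c\<close>. On the other hand \<open>E\<close> occupies a fixed fraction of \<open>\<Union>S\<close>, so a fixed fraction of the
pairs of points of \<open>q\<close> are pairs of points of \<open>E\<close> at a distance comparable to the side of \<open>q\<close>. For
such a pair the values of \<open>f\<close>, hence those of \<open>u\<close>, differ by a fixed fraction of the diameter of
\<open>f ` E\<close>, which contradicts the upper bound if \<open>\<epsilon>\<close> and \<open>c\<close> are small.\<close>

lemma flat_cubes_miss_a_fraction:
  fixes H :: "real \<Rightarrow> real" and \<tau> :: real
  assumes n: "2 \<le> CARD('n::finite)" and H: "\<And>t. 0 < t \<Longrightarrow> 1 \<le> H t" and t: "0 < \<tau>" "\<tau> \<le> 1"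
  shows "\<exists>\<epsilon> c. 0 < \<epsilon> \<and> \<epsilon> \<le> 1 \<and> 0 < c \<and> c < 1 \<and> flat_cubes_miss H \<tau> \<epsilon> c TYPE('n)"
proof -
  let ?d = "CARD('n)"
  define \<omega> where "\<omega> = unit_ball_vol (real ?d)"
  have w: "0 < \<omega>" unfolding \<omega>_def by (rule unit_ball_vol_pos) simp
  \<comment> \<open>A ball of radius \<open>\<beta>\<close> has a volume of at most \<open>\<tau> / 4\<close>.\<close>
  define \<beta> where "\<beta> = min 1 (\<tau> / (4 * \<omega>))"
  have b: "0 < \<beta>" "\<beta> \<le> 1" using w t by (auto simp: \<beta>_def)
  have "\<omega> * \<beta> ^ ?d \<le> \<omega> * \<beta>"
    using power_decreasing[of 1 ?d \<beta>] b w n by (intro mult_left_mono) auto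
  also have "\<dots> \<le> \<omega> * (\<tau> / (4 * \<omega>))" using w by (intro mult_left_mono) (auto simp: \<beta>_def)
  finally have wb: "\<omega> * \<beta> ^ ?d \<le> \<tau> / 4" using w by simp
  \<comment> \<open>Six diameters of a cube suffice to contain the cube, its representative and those of its
    neighbours that are not larger.\<close>
  define A where "A = 6 * real ?d"
  have A: "2 * real ?d < A" "0 < A" by (auto simp: A_def)
  define C1 where "C1 = 2 * H (2 * A / \<beta>)"
  define h where "h = H (real ?d / \<beta>)"
  define V where "V = \<omega> * (40 * H 1 * A) ^ ?d"
  have C1: "2 \<le> C1" using H[of "2 * A / \<beta>"] A b by (simp add: C1_def)
  have h: "1 \<le> h" using H[of "real ?d / \<beta>"] b by (simp add: h_def)
  have V: "0 \<le> V" using H[of 1] A w by (simp add: V_def)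
  \<comment> \<open>By the Poincare inequality, the separated pairs of points of \<open>E\<close> force an average slope of at
    least \<open>k\<close> times that of \<open>f\<close> on \<open>q\<close>. The three
    contributions to the upper bound (steep gap cubes, the other gap cubes, flat cubes) are made at
    most \<open>k / 4\<close> each, by choosing the level \<open>\<mu>\<close> first, then \<open>c\<close>, and \<open>\<epsilon>\<close> independently.\<close>
  define k where "k = \<tau>\<^sup>2 / (32 * h * 2 ^ (?d + 1) * ?d)"
  have k: "0 < k" using t h by (simp add: k_def)
  define \<mu> where "\<mu> = max 1 (8 * V / k)"
  have mu: "1 \<le> \<mu>" "2 * V / \<mu> \<le> k / 4"
  proof -
    show 1: "1 \<le> \<mu>" by (simp add: \<mu>_def)
    have "8 * V / k \<le> \<mu>" by (simp add: \<mu>_def)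
    then show "2 * V / \<mu> \<le> k / 4" using 1 k by (simp add: divide_simps mult.commute)
  qed
  define c where "c = min (\<tau> / 2) (k / (4 * \<mu>))"
  have c: "0 < c" "c < 1" "c \<le> \<tau> / 2" "\<mu> * c \<le> k / 4"
  proof -
    show "0 < c" "c < 1" "c \<le> \<tau> / 2" using t k mu by (auto simp: c_def min_less_iff_disj)
    have "\<mu> * c \<le> \<mu> * (k / (4 * \<mu>))" using mu by (intro mult_left_mono) (auto simp: c_def)
    then show "\<mu> * c \<le> k / 4" using mu by simp
  qed
  define \<epsilon> where "\<epsilon> = min (k / (4 * C1)) (1 / (8 * h * C1))"
  have e: "0 < \<epsilon>" "C1 * \<epsilon> \<le> k / 4" "C1 * \<epsilon> \<le> 1 / (8 * h)" "\<epsilon> \<le> 1"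
  proof -
    have "1 * 1 \<le> 8 * h * C1" using h C1 by (intro mult_mono) auto
    then have "1 / (8 * h * C1) \<le> 1" using h C1 by (simp add: divide_le_eq)
    then show "\<epsilon> \<le> 1" by (simp add: \<epsilon>_def min_le_iff_disj)
    show "0 < \<epsilon>" using k C1 h by (auto simp: \<epsilon>_def)
    have "C1 * \<epsilon> \<le> C1 * (k / (4 * C1))" "C1 * \<epsilon> \<le> C1 * (1 / (8 * h * C1))"
      using C1 by (intro mult_left_mono; auto simp: \<epsilon>_def)+
    then show "C1 * \<epsilon> \<le> k / 4" "C1 * \<epsilon> \<le> 1 / (8 * h)" using C1 h by auto
  qed
  have main: "(\<Sum>p\<in>S. snd p ^ ?d) \<le> (1 - c) * snd q ^ ?d"
    if d: "distortion H E f" and bd: "bounded (f ` E)" and E: "E \<in> sets borel" and l: "0 < snd q"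
    and Eq: "E \<subseteq> cube q" and D: "0 < diameter (f ` E)" and th: "\<tau> * snd q ^ ?d \<le> measure lborel E"
    and P: "finite P" and SP: "S \<subseteq> P" and side: "\<And>p. p \<in> P \<Longrightarrow> 0 < snd p \<and> snd p \<le> snd q"
    and disj: "pairwise (\<lambda>p p'. disjnt (cube p) (cube p')) P" and cov: "(\<Union>p\<in>P. cube p) = cube q"
    and rep: "\<And>p. p \<in> P \<Longrightarrow> rep p \<in> E" 
         "\<And>p x. p \<in> P \<Longrightarrow> x \<in> cube p \<Longrightarrow> dist x (rep p) \<le> 2 * real ?d * snd p"
    and flat: "\<And>p. p \<in> S \<Longrightarrow> \<tau> * snd p ^ ?d \<le> measure lborel (E \<inter> cube p)"
        "\<And>p. p \<in> S \<Longrightarrow> diameter (f ` (E \<inter> cube p)) \<le> \<epsilon> * (diameter (f ` E) / snd q) * snd p"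
    for E :: "(real^'n) set" and f :: "real^'n \<Rightarrow> real^'n" and q P S rep
  proof (rule ccontr)
    assume neg: "\<not> ?thesis"
    define l where "l = snd q"
    define Df where "Df = diameter (f ` E)"
    have l0: "0 < l" and Df: "0 < Df" using l D by (auto simp: l_def Df_def)
    have bdS: "bounded (f ` (E \<inter> X))" for X by (rule bounded_subset[OF bd]) auto
    define cs where "cs p = diameter (f ` (E \<inter> ball (rep p) (A * snd p)))" for p
    have cs0: "0 \<le> cs p" for p unfolding cs_def by (rule diameter_ge_0[OF bdS])
    have finS: "finite S" using SP P by (rule finite_subset)
    have disjS: "pairwise (\<lambda>p p'. disjnt (cube p) (cube p')) S'" if "S' \<subseteq> P" for S'
      using disj that by (rule pairwise_subset)
    have near: "dist (rep p) (rep p') < A * snd p" if "p \<in> P" "p' \<in> P" "x \<in> cube p" "y \<in> cube p'"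
      "dist x y \<le> snd p" "snd p' \<le> snd p" for p p' x y
    proof -
      have "dist (rep p) (rep p') \<le> dist x (rep p) + dist x y + dist y (rep p')"
        using dist_triangle[of "rep p" "rep p'" x] dist_triangle[of x "rep p'" y]
        by (simp add: dist_commute)
      also have "\<dots> \<le> 2 * real ?d * snd p + snd p + 2 * real ?d * snd p"
      proof (intro add_mono rep(2) that)
        have "dist y (rep p') \<le> 2 * real ?d * snd p'" by (intro rep(2) that)
        also have "\<dots> \<le> 2 * real ?d * snd p" using that by (intro mult_left_mono) auto
        finally show "dist y (rep p') \<le> 2 * real ?d * snd p" .
      qed
      also have "\<dots> = (4 * real ?d + 1) * snd p" by (simp add: algebra_simps)
      also have "\<dots> < A * snd p" 
        using side[OF that(1)] n by (intro mult_strict_right_mono) (auto simp: A_def)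
      finally show ?thesis .
    qed
    have inb: "x \<in> ball (rep p) (A * snd p)" if "p \<in> P" "x \<in> cube p" for p x
    proof -
      have "2 * real ?d * snd p < A * snd p" using A side[OF that(1)] by (intro mult_strict_right_mono) auto
      then show ?thesis using rep(2)[OF that] by (simp add: dist_commute)
    qed
    have csflat: "cs p \<le> C1 * \<epsilon> * (Df / l) * snd p" if p: "p \<in> S" for p
    proof -
      have pP: "p \<in> P" using p SP by blast
      have s: "0 < snd p" using side[OF pP] by simp
      obtain y z where yz: "y \<in> E \<inter> cube p" "z \<in> E \<inter> cube p" "\<beta> * snd p \<le> dist y z"
        using thick_imp_separated_points[OF s _ b(1) flat(1)[OF p]] wb t unfolding \<omega>_def by auto
      have "cs p \<le> C1 * diameter (f ` (E \<inter> cube p))"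
        unfolding cs_def
      proof (rule diameter_le)
        have "0 \<le> C1 * diameter (f ` (E \<inter> cube p))" using C1 diameter_ge_0[OF bdS] by simp
        then show "f ` (E \<inter> ball (rep p) (A * snd p)) \<noteq> {} \<or> 0 \<le> C1 * diameter (f ` (E \<inter> cube p))" by simp
        fix a b' assume "a \<in> f ` (E \<inter> ball (rep p) (A * snd p))" "b' \<in> f ` (E \<inter> ball (rep p) (A * snd p))"
        then show "norm (a - b') \<le> C1 * diameter (f ` (E \<inter> cube p))"
          using thick_neighbourhood_diameter[OF d bd s b(1) A(1) yz rep(2)[OF pP]]
          unfolding C1_def dist_norm by blast
      qed
      also have "\<dots> \<le> C1 * (\<epsilon> * (Df / l) * snd p)"
        using C1 flat(2)[OF p] by (intro mult_left_mono) (auto simp: Df_def l_def)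
      finally show ?thesis by (simp add: mult.assoc)
    qed
    have csflat': "cs p \<le> C1 * \<epsilon> * Df" if p: "p \<in> S" for p
    proof -
      have "C1 * \<epsilon> * (Df / l) * snd p \<le> C1 * \<epsilon> * (Df / l) * l"
        using C1 e Df l0 side[of p] p SP by (intro mult_left_mono) (auto simp: l_def)
      then show ?thesis using csflat[OF p] l0 by simp
    qed
    have allP: "(\<Sum>p\<in>P. snd p ^ ?d) = l ^ ?d"
      using disjoint_cubes_sum[OF P _ disj] side l measure_cube[of q] by (simp add: cov l_def)
    have gap: "(\<Sum>p\<in>P - S. snd p ^ ?d) \<le> c * l ^ ?d"
      using neg sum.subset_diff[OF SP P, of "\<lambda>p. snd p ^ ?d"] allP by (simp add: l_def algebra_simps)
    have sumS: "(\<Sum>p\<in>S. snd p ^ ?d) \<le> l ^ ?d"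
      unfolding allP[symmetric] by (intro sum_mono2 P SP) (use side in \<open>auto simp: less_imp_le\<close>)
    define m where "m = \<mu> * (Df / l)"
    have m: "0 < m" using mu Df l0 by (simp add: m_def)
    have s1: "(\<Sum>p\<in>S. cs p * snd p ^ (?d - 1)) \<le> C1 * \<epsilon> * (Df / l) * l ^ ?d"
    proof -
      have "(\<Sum>p\<in>S. cs p * snd p ^ (?d - 1)) \<le> (\<Sum>p\<in>S. C1 * \<epsilon> * (Df / l) * snd p * snd p ^ (?d - 1))"
        by (intro sum_mono mult_right_mono csflat zero_le_power) (use side SP in \<open>auto simp: less_imp_le\<close>)
      also have "\<dots> = C1 * \<epsilon> * (Df / l) * (\<Sum>p\<in>S. snd p ^ ?d)"
        unfolding sum_distrib_left by (intro sum.cong) (use n in \<open>auto simp: power_eq_if\<close>)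
      also have "\<dots> \<le> C1 * \<epsilon> * (Df / l) * l ^ ?d"
        using C1 e Df l0 by (intro mult_left_mono sumS) auto
      finally show ?thesis .
    qed
    have s2: "(\<Sum>p\<in>P - S. cs p * snd p ^ (?d - 1)) \<le> (\<mu> * c + 2 * V / \<mu>) * (Df / l) * l ^ ?d"
    proof -
      have "(\<Sum>p\<in>P - S. cs p * snd p ^ (?d - 1)) \<le> m * (\<Sum>p\<in>P - S. snd p ^ ?d) + 2 * m * (V * (Df / m) ^ ?d)"
        unfolding cs_def V_def \<omega>_def Df_def
        by (rule gap_cubes_sum[OF d bd m A(1) n]) (use P side rep disjS in auto)
      also have "m * (\<Sum>p\<in>P - S. snd p ^ ?d) \<le> m * (c * l ^ ?d)" using m by (intro mult_left_mono gap) auto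
      also have "Df / m = l / \<mu>" using Df by (simp add: m_def)
      also have "2 * m * (V * (l / \<mu>) ^ ?d) \<le> 2 * m * (V * (l ^ ?d / \<mu>\<^sup>2))"
      proof (intro mult_left_mono)
        show "(l / \<mu>) ^ ?d \<le> l ^ ?d / \<mu>\<^sup>2"
          unfolding power_divide by (rule divide_left_mono) (use l0 mu n in \<open>auto intro: power_increasing\<close>)
      qed (use V m in auto)
      also have "m * (c * l ^ ?d) + 2 * m * (V * (l ^ ?d / \<mu>\<^sup>2)) = (\<mu> * c + 2 * V / \<mu>) * (Df / l) * l ^ ?d"
        using mu by (simp add: m_def power2_eq_square divide_simps) (simp add: algebra_simps)
      finally show ?thesis by simp
    qed
    have K: "(\<Sum>p\<in>P. cs p * snd p ^ (?d - 1)) \<le> 3 / 4 * k * (Df / l) * l ^ ?d"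
    proof -
      have "(\<Sum>p\<in>P. cs p * snd p ^ (?d - 1)) \<le> (\<mu> * c + 2 * V / \<mu>) * (Df / l) * l ^ ?d + C1 * \<epsilon> * (Df / l) * l ^ ?d"
        using s1 s2 sum.subset_diff[OF SP P, of "\<lambda>p. cs p * snd p ^ (?d - 1)"] by simp
      also have "\<dots> = (\<mu> * c + 2 * V / \<mu> + C1 * \<epsilon>) * ((Df / l) * l ^ ?d)" by (simp add: algebra_simps)
      also have "\<dots> \<le> (3 / 4 * k) * ((Df / l) * l ^ ?d)"
        using c(4) mu(2) e(2) Df l0 by (intro mult_right_mono) auto
      finally show ?thesis by simp
    qed
    define u where "u x = (\<Sum>p\<in>P. indicator (cube p) x *\<^sub>R f (rep p))" for x
    have um [measurable]: "u \<in> borel_measurable borel" unfolding u_def by measurable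
    have u: "u x = f (rep p)" if p: "p \<in> P" "x \<in> cube p" for p x
    proof -
      have "indicator (cube p') x *\<^sub>R f (rep p') = (if p' = p then f (rep p) else 0)" if "p' \<in> P" for p'
        using disj that p by (auto simp: pairwise_def disjnt_iff)
      then have "u x = (\<Sum>p'\<in>P. if p' = p then f (rep p) else 0)" unfolding u_def by (intro sum.cong) auto
      also have "\<dots> = f (rep p)" using P p by simp
      finally show ?thesis .
    qed
    define r where "r = Min (insert 1 (snd ` P))"
    have r: "0 < r" unfolding r_def using P side by (subst Min_gr_iff) auto
    have rle: "r \<le> snd p" if "p \<in> P" for p unfolding r_def using P that by (intro Min_le) auto
    have jump: "u x = u y \<or> (\<exists>p\<in>P. dist (u x) (u y) \<le> cs p \<and> (x \<in> cube p \<longleftrightarrow> y \<notin> cube p))"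
      if xy: "x \<in> cube q" "y \<in> cube q" "dist x y \<le> r" for x y
    proof -
      obtain p where p: "p \<in> P" "x \<in> cube p" using cov xy by blast
      obtain p' where p': "p' \<in> P" "y \<in> cube p'" using cov xy by blast
      show ?thesis
      proof (cases "p = p'")
        case True then show ?thesis using u p p' by simp
      next
        case False
        then have notin: "x \<notin> cube p'" "y \<notin> cube p"
          using disj p p' by (auto simp: pairwise_def disjnt_iff)
        show ?thesis
        proof (cases "snd p' \<le> snd p")
          case True
          have "dist (f (rep p)) (f (rep p')) \<le> cs p" unfolding cs_def
          proof (rule diameter_bounded_bound[OF bdS])
            show "f (rep p) \<in> f ` (E \<inter> ball (rep p) (A * snd p))"
              using rep(1)[OF p(1)] side[OF p(1)] A by auto
            show "f (rep p') \<in> f ` (E \<inter> ball (rep p) (A * snd p))"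
              using rep(1)[OF p'(1)] near[OF p(1) p'(1) p(2) p'(2) _ True] xy rle[OF p(1)] by auto
          qed
          then show ?thesis using u p p' notin by auto
        next
          case False
          have "dist (f (rep p')) (f (rep p)) \<le> cs p'" unfolding cs_def
          proof (rule diameter_bounded_bound[OF bdS])
            show "f (rep p') \<in> f ` (E \<inter> ball (rep p') (A * snd p'))"
              using rep(1)[OF p'(1)] side[OF p'(1)] A by auto
            show "f (rep p) \<in> f ` (E \<inter> ball (rep p') (A * snd p'))"
              using rep(1)[OF p(1)] near[OF p'(1) p(1) p'(2) p(2)] False xy rle[OF p'(1)] by (auto simp: dist_commute)
          qed
          then show ?thesis using u p p' notin by (auto simp: dist_commute)
        qed
      qed
    qed
    let ?I = "\<integral>\<^sup>+x. \<integral>\<^sup>+y. ennreal (dist (u x) (u y)) * indicator (cube q \<times> cube q) (x, y) \<partial>lborel \<partial>lborel"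
    have "?I \<le> ennreal (2 ^ (?d + 1) * ?d * l ^ (?d + 1) * (\<Sum>p\<in>P. cs p * snd p ^ (?d - 1)))"
      unfolding l_def by (rule piecewise_constant_poincare[OF P _ cs0 um l r jump]) (use side in \<open>auto simp: less_imp_le\<close>)
    also have "\<dots> \<le> ennreal (2 ^ (?d + 1) * ?d * l ^ (?d + 1) * (3 / 4 * k * (Df / l) * l ^ ?d))"
      by (intro ennreal_leI mult_left_mono K) (use l0 in auto)
    also have "2 ^ (?d + 1) * ?d * l ^ (?d + 1) * (3 / 4 * k * (Df / l) * l ^ ?d) = 3 / 4 * (\<tau>\<^sup>2 / (32 * h) * Df * (l ^ ?d * l ^ ?d))"
      using l0 h by (simp add: k_def divide_simps)
    finally have upper: "?I \<le> ennreal (3 / 4 * (\<tau>\<^sup>2 / (32 * h) * Df * (l ^ ?d * l ^ ?d)))" .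
    \<comment> \<open>\<open>T\<close> is the part of \<open>E\<close> on which \<open>u\<close> is close to \<open>f\<close>.\<close>
    define T where "T = E \<inter> (\<Union>p\<in>S. cube p)"
    have Efm: "E \<in> fmeasurable lborel" 
      by (rule fmeasurableI2[OF fmeasurable_cube[of q] Eq]) (use E l in auto)
    have Tfm: "T \<in> fmeasurable lborel" unfolding T_def
      by (rule fmeasurableI2[OF Efm]) (use E finS in auto)
    have Tm: "\<tau> / 2 * l ^ ?d \<le> measure lborel T"
    proof -
      have "measure lborel E \<le> measure lborel (T \<union> (\<Union>p\<in>P - S. cube p))"
      proof (rule measure_mono_fmeasurable)
        show "E \<subseteq> T \<union> (\<Union>p\<in>P - S. cube p)"
        proof
          fix x assume x: "x \<in> E"
          then obtain p where "p \<in> P" "x \<in> cube p" using Eq cov by blast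
          then show "x \<in> T \<union> (\<Union>p\<in>P - S. cube p)" using x by (cases "p \<in> S") (auto simp: T_def)
        qed
        show "T \<union> (\<Union>p\<in>P - S. cube p) \<in> fmeasurable lborel"
          by (intro fmeasurable.Un Tfm fmeasurable.finite_UN) (use P side in \<open>auto simp: less_imp_le\<close>)
      qed (use E in simp)
      also have "\<dots> \<le> measure lborel T + measure lborel (\<Union>p\<in>P - S. cube p)"
        by (rule measure_Un_le) (use Tfm P in auto)
      also have "measure lborel (\<Union>p\<in>P - S. cube p) = (\<Sum>p\<in>P - S. snd p ^ ?d)"
        by (rule disjoint_cubes_sum[symmetric]) (use P side disjS in auto)
      also have "\<dots> \<le> c * l ^ ?d" by (rule gap)
      also have "\<dots> \<le> \<tau> / 2 * l ^ ?d" using c(3) l0 by (intro mult_right_mono) auto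
      finally show ?thesis using th by (simp add: l_def)
    qed
    have low: "Df / (4 * h) \<le> dist (u x) (u y)" if x: "x \<in> T" and y: "y \<in> T - ball x (\<beta> * l)" for x y
    proof -
      obtain p where p: "p \<in> S" "x \<in> cube p" and xE: "x \<in> E" using x by (auto simp: T_def)
      obtain p' where p': "p' \<in> S" "y \<in> cube p'" and yE: "y \<in> E" using y by (auto simp: T_def)
      have pP: "p \<in> P" "p' \<in> P" using p p' SP by auto
      have far: "\<beta> * l \<le> dist x y" using y by auto
      have zb: "dist (f x) (f z) \<le> h * dist (f x) (f y)" if z: "z \<in> E" for z
        unfolding h_def
      proof (rule distortionD[OF d xE z yE])
        have "dist x z \<le> real ?d * l"
          using dist_in_cube[of x q z] xE z Eq by (auto simp: l_def)
        also have "\<dots> = real ?d / \<beta> * (\<beta> * l)" using b by simp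
        also have "\<dots> \<le> real ?d / \<beta> * dist x y" using far b by (intro mult_left_mono) auto
        finally show "dist x z \<le> real ?d / \<beta> * dist x y" .
      qed (use b in auto)
      have "Df \<le> 2 * h * dist (f x) (f y)" unfolding Df_def
      proof (rule diameter_le)
        fix a b' assume "a \<in> f ` E" "b' \<in> f ` E"
        then obtain z z' where z: "z \<in> E" "z' \<in> E" "a = f z" "b' = f z'" by blast
        have "dist a b' \<le> dist (f x) a + dist (f x) b'" by (rule dist_triangle3)
        then show "norm (a - b') \<le> 2 * h * dist (f x) (f y)"
          using zb[OF z(1)] zb[OF z(2)] z unfolding dist_norm by simp
      qed (use xE in auto)
      then have 1: "Df / (2 * h) \<le> dist (f x) (f y)" using h by (simp add: pos_divide_le_eq mult.commute)
      have close: "dist (f x) (u x) \<le> Df / (8 * h)" if "x \<in> E" "p \<in> S" "x \<in> cube p" for x p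
      proof -
        have pP: "p \<in> P" using that SP by blast
        have "dist (f x) (f (rep p)) \<le> cs p" unfolding cs_def
        proof (rule diameter_bounded_bound[OF bdS])
          show "f x \<in> f ` (E \<inter> ball (rep p) (A * snd p))" using inb[OF pP] that by blast
          show "f (rep p) \<in> f ` (E \<inter> ball (rep p) (A * snd p))"
              using rep(1)[OF pP] side[OF pP] A by auto
        qed
        also have "\<dots> \<le> C1 * \<epsilon> * Df" by (rule csflat'[OF that(2)])
        also have "\<dots> \<le> 1 / (8 * h) * Df" using e(3) Df by (intro mult_right_mono) auto
        finally show ?thesis using u[OF pP that(3)] by simp
      qed
      have "dist (f x) (f y) \<le> dist (f x) (u x) + dist (u x) (u y) + dist (f y) (u y)"
        using dist_triangle[of "f x" "f y" "u x"] dist_triangle[of "u x" "f y" "u y"]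
        by (simp add: dist_commute)
      with 1 close[OF xE p] close[OF yE p'] have "Df / (2 * h) - 2 * (Df / (8 * h)) \<le> dist (u x) (u y)" by linarith
      moreover have "Df / (2 * h) - 2 * (Df / (8 * h)) = Df / (4 * h)" using h by (simp add: divide_simps)
      ultimately show ?thesis by simp
    qed
    have ball_small: "measure lborel (ball x (\<beta> * l)) \<le> \<tau> / 4 * l ^ ?d" for x :: "real^'n"
    proof -
      have "measure lborel (ball x (\<beta> * l)) = \<omega> * \<beta> ^ ?d * l ^ ?d"
        using b l0 by (simp add: content_ball \<omega>_def power_mult_distrib)
      also have "\<dots> \<le> \<tau> / 4 * l ^ ?d" using wb l0 by (intro mult_right_mono) auto
      finally show ?thesis .
    qed
    have Tq: "T \<subseteq> cube q" using Eq by (auto simp: T_def)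
    define a where "a = Df / (4 * h) * (\<tau> / 4 * l ^ ?d)"
    have a0: "0 \<le> a" using Df h t l0 by (simp add: a_def)
    have inner: "ennreal a * indicator T x \<le> (\<integral>\<^sup>+y. ennreal (dist (u x) (u y)) * indicator (cube q \<times> cube q) (x, y) \<partial>lborel)" for x
    proof (cases "x \<in> T")
      case True
      have "\<tau> / 4 * l ^ ?d \<le> measure lborel T - measure lborel (ball x (\<beta> * l))"
        using Tm ball_small[of x] by simp
      also have "\<dots> \<le> measure lborel (T - ball x (\<beta> * l))"
        by (rule measure_diff_le_measure_setdiff[OF Tfm fmeasurable_ball])
      finally have "ennreal (\<tau> / 4 * l ^ ?d) \<le> emeasure lborel (T - ball x (\<beta> * l))"
        using fmeasurable.Diff[OF Tfm fmeasurable_ball] by (subst emeasure_eq_measure2) (auto intro!: ennreal_leI)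
      then have "ennreal (Df / (4 * h)) * ennreal (\<tau> / 4 * l ^ ?d) \<le> ennreal (Df / (4 * h)) * emeasure lborel (T - ball x (\<beta> * l))"
        by (rule mult_left_mono) simp
      also have "\<dots> = (\<integral>\<^sup>+y. ennreal (Df / (4 * h)) * indicator (T - ball x (\<beta> * l)) y \<partial>lborel)"
        using Tfm by (subst nn_integral_cmult_indicator) auto
      also have "\<dots> \<le> (\<integral>\<^sup>+y. ennreal (dist (u x) (u y)) * indicator (cube q \<times> cube q) (x, y) \<partial>lborel)"
        by (rule nn_integral_mono) (use low[OF True] True Tq in \<open>auto simp: indicator_def intro!: ennreal_leI\<close>)
      finally show ?thesis using True Df h t l0 by (simp add: a_def ennreal_mult[symmetric])
    qed simp
    have "ennreal (a * (\<tau> / 2 * l ^ ?d)) = ennreal a * ennreal (\<tau> / 2 * l ^ ?d)"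
      by (rule ennreal_mult) (use a0 t l0 in auto)
    also have "\<dots> \<le> ennreal a * emeasure lborel T"
      using Tm Tfm by (intro mult_left_mono) (auto simp: emeasure_eq_measure2 intro!: ennreal_leI)
    also have "\<dots> = (\<integral>\<^sup>+x. ennreal a * indicator T x \<partial>lborel)"
      using Tfm by (subst nn_integral_cmult_indicator) auto
    also have "\<dots> \<le> ?I" by (rule nn_integral_mono) (rule inner)
    also note upper
    finally have "a * (\<tau> / 2 * l ^ ?d) \<le> 3 / 4 * (\<tau>\<^sup>2 / (32 * h) * Df * (l ^ ?d * l ^ ?d))"
      by (subst (asm) ennreal_le_iff) (use t h Df l0 in auto)
    also have "\<dots> < 1 * (\<tau>\<^sup>2 / (32 * h) * Df * (l ^ ?d * l ^ ?d))"
      by (rule mult_strict_right_mono) (use t h Df l0 in auto)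
    also have "\<dots> = a * (\<tau> / 2 * l ^ ?d)"
      by (simp add: a_def power2_eq_square)
    finally show False by simp
  qed
  have "flat_cubes_miss H \<tau> \<epsilon> c TYPE('n)"
    unfolding flat_cubes_miss_def
  proof (intro allI impI)
    fix E :: "(real^'n) set" and f :: "real^'n \<Rightarrow> real^'n" and q :: "(real^'n) \<times> real"
      and P S :: "((real^'n) \<times> real) set" and rep :: "(real^'n) \<times> real \<Rightarrow> real^'n"
    assume hyps: "distortion H E f" "bounded (f ` E)" "E \<in> sets borel" "0 < snd q" "E \<subseteq> cube q"
      "0 < diameter (f ` E)" "\<tau> * snd q ^ ?d \<le> measure lborel E"
      and P: "adapted_partition E q P rep" and SP: "S \<subseteq> P"
      and S: "\<forall>p\<in>S. flat_cube \<tau> E f (\<epsilon> * (diameter (f ` E) / snd q)) p"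
    show "(\<Sum>p\<in>S. snd p ^ ?d) \<le> (1 - c) * snd q ^ ?d"
      by (rule main[OF hyps _ SP, where rep=rep]; use P S in \<open>simp add: adapted_partition_def flat_cube_def\<close>)
  qed
  then show ?thesis using e(1,4) c(1,2) by blast
qed

section \<open>Dyadic cubes of small oscillation\<close>

text \<open>The dyadic cube of side \<open>2 ^ (- k)\<close> that contains \<open>x\<close>. Indexing dyadic cubes by their points makes
nestedness a statement about floors.\<close>

definition dyad :: "nat \<Rightarrow> real^'n \<Rightarrow> (real^'n) \<times> real" where
  "dyad k x = ((\<chi> i. of_int \<lfloor>2 ^ k * x $ i\<rfloor> / 2 ^ k), 1 / 2 ^ k)"

lemma snd_dyad [simp]: "snd (dyad k x) = 1 / 2 ^ k"
  by (simp add: dyad_def)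

lemma mem_dyad: "y \<in> cube (dyad k x) \<longleftrightarrow> (\<forall>i. \<lfloor>2 ^ k * y $ i\<rfloor> = \<lfloor>2 ^ k * x $ i\<rfloor>)"
proof -
  have "(real_of_int m / 2 ^ k \<le> b \<and> b < real_of_int m / 2 ^ k + 1 / 2 ^ k) \<longleftrightarrow> \<lfloor>2 ^ k * b\<rfloor> = m" for b m
  proof -
    have "\<lfloor>2 ^ k * b\<rfloor> = m \<longleftrightarrow> real_of_int m \<le> 2 ^ k * b \<and> 2 ^ k * b < real_of_int m + 1"
      by (auto simp: floor_eq_iff)
    also have "real_of_int m \<le> 2 ^ k * b \<longleftrightarrow> real_of_int m / 2 ^ k \<le> b"
      by (simp add: pos_divide_le_eq mult.commute)
    also have "2 ^ k * b < real_of_int m + 1 \<longleftrightarrow> b < real_of_int m / 2 ^ k + 1 / 2 ^ k"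
      by (simp add: add_divide_distrib[symmetric] pos_less_divide_eq mult.commute)
    finally show ?thesis by blast
  qed
  then show ?thesis by (simp add: cube_def dyad_def)
qed

lemma mem_dyad_self [simp]: "x \<in> cube (dyad k x)"
  by (simp add: mem_dyad)

lemma dyad_eqI: "y \<in> cube (dyad k x) \<Longrightarrow> dyad k y = dyad k x"
  unfolding mem_dyad by (simp add: dyad_def)

lemma dyad_nested:
  assumes "j \<le> k" "y \<in> cube (dyad k x)"
  shows "y \<in> cube (dyad j x)"
proof -
  have eq: "\<lfloor>2 ^ j * b\<rfloor> = \<lfloor>2 ^ k * b\<rfloor> div 2 ^ (k - j)" for b :: real
  proof -
    have "(2::real) ^ k = 2 ^ j * 2 ^ (k - j)" using assms(1) by (simp add: power_add[symmetric])
    then have "2 ^ j * b = 2 ^ k * b / of_int (2 ^ (k - j))" by simp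
    then show ?thesis by (simp only: floor_divide_real_eq_div[of "2 ^ (k - j)" "2 ^ k * b"] zero_le_power zero_le_numeral)
  qed
  show ?thesis using assms(2) by (simp add: mem_dyad eq)
qed

lemma dyad_nested_subset: "j \<le> k \<Longrightarrow> cube (dyad k x) \<subseteq> cube (dyad j x)"
  using dyad_nested by blast

abbreviation unit_cube :: "(real^'n) set" where "unit_cube \<equiv> cube (0, 1)"

lemma dyad_0: "x \<in> unit_cube \<Longrightarrow> dyad 0 x = (0, 1)"
  by (auto simp: dyad_def cube_def vec_eq_iff floor_eq_iff)

lemma dyad_subset_unit: "x \<in> unit_cube \<Longrightarrow> cube (dyad k x) \<subseteq> unit_cube"
  using dyad_nested_subset[of 0 k x] by (simp add: dyad_0)

lemma finite_dyads: "finite (dyad k ` (unit_cube :: (real^'n) set))"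
proof (rule finite_subset)
  show "dyad k ` (unit_cube :: (real^'n) set) \<subseteq> (\<lambda>m. (\<chi> i. of_int (m i) / 2 ^ k, 1 / 2 ^ k)) ` (PiE UNIV (\<lambda>_. {0..<2 ^ k}))"
  proof
    fix p assume "p \<in> dyad k ` (unit_cube :: (real^'n) set)"
    then obtain x :: "real^'n" where x: "x \<in> unit_cube" "p = dyad k x" by blast
    have "0 \<le> \<lfloor>2 ^ k * x $ i\<rfloor> \<and> \<lfloor>2 ^ k * x $ i\<rfloor> < 2 ^ k" for i
    proof -
      have "0 \<le> x $ i" "x $ i < 1" using x(1) by (auto simp: cube_def)
      then have "0 \<le> 2 ^ k * x $ i" "2 ^ k * x $ i < real_of_int (2 ^ k)" by auto
      then show ?thesis by (simp only: floor_less_iff zero_le_floor)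
    qed
    then show "p \<in> (\<lambda>m. (\<chi> i. of_int (m i) / 2 ^ k, 1 / 2 ^ k)) ` (PiE UNIV (\<lambda>_. {0..<2 ^ k}))"
      unfolding x(2) dyad_def by (intro image_eqI[of _ _ "\<lambda>i. \<lfloor>2 ^ k * x $ i\<rfloor>"]) auto
  qed
qed (auto intro!: finite_imageI finite_PiE)

text \<open>The family of maximal dyadic cubes with the property \<open>st\<close>, for the points of \<open>X\<close>.\<close>

definition stopped :: "(nat \<Rightarrow> real^'n \<Rightarrow> bool) \<Rightarrow> (real^'n) set \<Rightarrow> ((real^'n) \<times> real) set" where
  "stopped st X = {dyad k x |k x. x \<in> X \<and> st k x \<and> (\<forall>j<k. \<not> st j x)}"

lemma stopped_family:
  assumes inv: "\<And>k x y. y \<in> cube (dyad k x) \<Longrightarrow> st k y = st k x"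
    and N: "\<And>k x. st k x \<Longrightarrow> k \<le> N" and X: "X \<subseteq> unit_cube"
    and sat: "\<And>k x y. x \<in> X \<Longrightarrow> st k x \<Longrightarrow> y \<in> cube (dyad k x) \<Longrightarrow> y \<in> X"
  shows "finite (stopped st X)"
    and "pairwise (\<lambda>p p'. disjnt (cube p) (cube p')) (stopped st X)"
    and "(\<Union>p\<in>stopped st X. cube p) = {x \<in> X. \<exists>k. st k x}"
proof -
  have "stopped st X \<subseteq> (\<Union>k\<le>N. dyad k ` unit_cube)"
    using N X by (fastforce simp: stopped_def)
  then show "finite (stopped st X)" by (rule finite_subset) (simp add: finite_dyads)
  have least: "st j y = st j x" if "y \<in> cube (dyad k x)" "j \<le> k" for x y j k
    using inv[OF dyad_nested[OF that(2,1)]] .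
  have canon: "dyad k x = dyad (LEAST k. st k z) z" 
    if "st k x" "\<forall>j<k. \<not> st j x" "z \<in> cube (dyad k x)" for k x z
  proof -
    have "(LEAST k. st k z) = k"
      using least[OF that(3)] that(1,2) by (intro Least_equality) (auto simp: not_less[symmetric])
    then show ?thesis using dyad_eqI[OF that(3)] by simp
  qed
  show "pairwise (\<lambda>p p'. disjnt (cube p) (cube p')) (stopped st X)"
  proof (rule pairwiseI)
    fix p p' assume p: "p \<in> stopped st X" "p' \<in> stopped st X" "p \<noteq> p'"
    obtain k x where x: "p = dyad k x" "st k x" "\<forall>j<k. \<not> st j x" using p(1) unfolding stopped_def by blast
    obtain k' x' where x': "p' = dyad k' x'" "st k' x'" "\<forall>j<k'. \<not> st j x'" using p(2) unfolding stopped_def by blast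
    show "disjnt (cube p) (cube p')"
      unfolding disjnt_iff using canon[OF x(2,3)] canon[OF x'(2,3)] x(1) x'(1) p(3) by metis
  qed
  show "(\<Union>p\<in>stopped st X. cube p) = {x \<in> X. \<exists>k. st k x}" (is "?L = ?R")
  proof
    show "?L \<subseteq> ?R" using sat inv unfolding stopped_def by blast
    show "?R \<subseteq> ?L"
    proof
      fix x assume "x \<in> ?R"
      then obtain k where k: "x \<in> X" "st k x" by blast
      have "dyad (LEAST k. st k x) x \<in> stopped st X"
        using k not_less_Least[of _ "\<lambda>k. st k x"] LeastI[of "\<lambda>k. st k x" k] unfolding stopped_def by blast
      then show "x \<in> ?L" by (rule UN_I) simp
    qed
  qed
qed

lemma dist_in_dyad: 
  fixes x y w :: "real^'n"
  assumes "y \<in> cube (dyad k x)" "w \<in> cube (dyad k x)"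
  shows "dist y w \<le> real CARD('n) * (1 / 2 ^ k)"
  using dist_in_cube[OF assms] by simp

text \<open>Thickness is required of all larger dyadic cubes as well, so that it passes to the parent of a cube
with the same constant.\<close>

definition thick :: "real \<Rightarrow> (real^'n) set \<Rightarrow> nat \<Rightarrow> real^'n \<Rightarrow> bool" where
  "thick \<tau> E k x \<longleftrightarrow> (\<forall>j\<le>k. \<tau> * (1 / 2 ^ j) ^ CARD('n) \<le> measure lborel (E \<inter> cube (dyad j x)))"

text \<open>The slope of \<open>f\<close> on a dyadic cube: the diameter of the image divided by the side.\<close>

definition osc :: "(real^'n) set \<Rightarrow> (real^'n \<Rightarrow> 'b::metric_space) \<Rightarrow> nat \<Rightarrow> real^'n \<Rightarrow> real" where
  "osc E f k x = diameter (f ` (E \<inter> cube (dyad k x))) * 2 ^ k"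

text \<open>The bound \<open>N\<close> on the level keeps all families of cubes finite. None of the estimates depends on it.\<close>

definition low :: "real \<Rightarrow> (real^'n) set \<Rightarrow> (real^'n \<Rightarrow> 'b::metric_space) \<Rightarrow> nat \<Rightarrow> real \<Rightarrow> nat \<Rightarrow> real^'n \<Rightarrow> bool" where
  "low \<tau> E f N t k x \<longleftrightarrow> k \<le> N \<and> thick \<tau> E k x \<and> osc E f k x \<le> t"

definition low_set :: "real \<Rightarrow> (real^'n) set \<Rightarrow> (real^'n \<Rightarrow> 'b::metric_space) \<Rightarrow> nat \<Rightarrow> real \<Rightarrow> (real^'n) set" where
  "low_set \<tau> E f N t = {x \<in> unit_cube. \<exists>k. low \<tau> E f N t k x}"

definition thin_set :: "real \<Rightarrow> (real^'n) set \<Rightarrow> nat \<Rightarrow> (real^'n) set" where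
  "thin_set \<tau> E N = {x \<in> unit_cube. \<exists>k\<le>N. measure lborel (E \<inter> cube (dyad k x)) < \<tau> * (1 / 2 ^ k) ^ CARD('n)}"

lemma thick_cong: "y \<in> cube (dyad k x) \<Longrightarrow> thick \<tau> E k y = thick \<tau> E k x"
  unfolding thick_def using dyad_nested dyad_eqI by metis

lemma thick_mono: "thick \<tau> E k x \<Longrightarrow> j \<le> k \<Longrightarrow> thick \<tau> E j x"
  unfolding thick_def by auto

lemma low_cong: "y \<in> cube (dyad k x) \<Longrightarrow> low \<tau> E f N t k y = low \<tau> E f N t k x"
  unfolding low_def osc_def using thick_cong[of y k x \<tau> E] dyad_eqI[of y k x] by simp

lemma low_cong': "y \<in> cube (dyad k x) \<Longrightarrow> j \<le> k \<Longrightarrow> low \<tau> E f N t j y = low \<tau> E f N t j x"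
  by (rule low_cong) (rule dyad_nested)

lemma low_mono: "low \<tau> E f N s k x \<Longrightarrow> s \<le> t \<Longrightarrow> low \<tau> E f N t k x"
  unfolding low_def by auto

lemma low_set_stopped:
  fixes f :: "real^'n \<Rightarrow> 'b::metric_space" and \<tau> t :: real and E N
  defines "Q \<equiv> stopped (low \<tau> E f N t) unit_cube"
  shows "finite Q" "pairwise (\<lambda>p p'. disjnt (cube p) (cube p')) Q" "(\<Union>p\<in>Q. cube p) = low_set \<tau> E f N t"
  unfolding Q_def low_set_def
  by (rule stopped_family[where N=N], erule low_cong, simp add: low_def, simp, use dyad_subset_unit in blast)+

lemma low_set_fmeasurable: "low_set \<tau> E f N t \<in> fmeasurable lborel"
proof -
  have "(\<Union>p\<in>stopped (low \<tau> E f N t) unit_cube. cube p) \<in> fmeasurable lborel"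
    by (intro fmeasurable.finite_UN low_set_stopped(1)) (auto simp: stopped_def)
  then show ?thesis unfolding low_set_stopped(3) .
qed

text \<open>Passing to a dyadic child cannot decrease the slope by more than a constant factor, since the image of
the parent is controlled by two separated points in the child.\<close>

lemma osc_parent:
  fixes f :: "real^'n \<Rightarrow> 'b::real_normed_vector"
  assumes d: "distortion H E f" and bd: "bounded (f ` E)" and \<tau>: "0 < \<tau>"
    and b: "0 < \<beta>" "unit_ball_vol (CARD('n)) * \<beta> ^ CARD('n) < \<tau>"
    and th: "thick \<tau> E (Suc k) x"
  shows "osc E f k x \<le> H (2 * CARD('n) / \<beta>) * osc E f (Suc k) x"
proof -
  let ?c = "dyad (Suc k) x" and ?h = "H (2 * CARD('n) / \<beta>)"
  have h: "1 \<le> ?h" using b by (intro distortion_ge_1[OF d]) simp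
  have bdS: "bounded (f ` (E \<inter> X))" for X by (rule bounded_subset[OF bd]) auto
  have "\<tau> * snd ?c ^ CARD('n) \<le> measure lborel (E \<inter> cube ?c)" using th by (auto simp: thick_def)
  then obtain y z where yz: "y \<in> E \<inter> cube ?c" "z \<in> E \<inter> cube ?c" "\<beta> * snd ?c \<le> dist y z"
    using thick_imp_separated_points[of ?c \<beta> \<tau> E] b by auto
  let ?D = "diameter (f ` (E \<inter> cube ?c))"
  have near: "dist (f y) (f w) \<le> ?h * ?D" if w: "w \<in> E \<inter> cube (dyad k x)" for w
  proof -
    have "y \<in> cube (dyad k x)" using yz dyad_nested[of k "Suc k" y x] by auto
    then have "dist y w \<le> real CARD('n) * (1 / 2 ^ k)" using dist_in_dyad w by blast
    also have "\<dots> = (2 * CARD('n) / \<beta>) * (\<beta> * snd ?c)" using b by simp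
    also have "\<dots> \<le> (2 * CARD('n) / \<beta>) * dist y z" using b by (intro mult_left_mono yz) auto
    finally have "dist (f y) (f w) \<le> ?h * dist (f y) (f z)"
      using yz w b by (intro distortionD[OF d]) auto
    also have "\<dots> \<le> ?h * ?D"
      using h yz by (intro mult_left_mono diameter_bounded_bound[OF bdS]) auto
    finally show ?thesis .
  qed
  have ub: "dist (f v) (f w) \<le> 2 * ?h * ?D" if "v \<in> E \<inter> cube (dyad k x)" "w \<in> E \<inter> cube (dyad k x)" for v w
    using near[OF that(1)] near[OF that(2)] dist_triangle3[of "f v" "f w" "f y"] by simp
  have "diameter (f ` (E \<inter> cube (dyad k x))) \<le> 2 * ?h * ?D"
  proof (rule diameter_le)
    have "0 \<le> ?D" by (rule diameter_ge_0[OF bdS])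
    then show "f ` (E \<inter> cube (dyad k x)) \<noteq> {} \<or> 0 \<le> 2 * ?h * ?D" using h by simp
  qed (use ub in \<open>auto simp: dist_norm\<close>)
  then have "diameter (f ` (E \<inter> cube (dyad k x))) * 2 ^ k \<le> 2 * ?h * ?D * 2 ^ k" by (rule mult_right_mono) simp
  then show ?thesis by (simp add: osc_def mult_ac)
qed

text \<open>The low set at level \<open>t\<close> is the disjoint union of the maximal cubes \<open>q\<close> whose slope is at most \<open>t\<close>.
By maximality the parent of \<open>q\<close> has a larger slope, so the slope of \<open>q\<close> is at least \<open>t / C\<close>.
Therefore the cubes of slope at most \<open>(\<epsilon> / C) t\<close> inside \<open>q\<close> are flat relative to \<open>q\<close> and miss a
fraction \<open>c\<close> of it. The partition of \<open>q\<close> needed for this consists of the maximal dyadic cubes that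
are either low at the new level or disjoint from the new low set; the parent of a cube of the
second kind contains a low cube, thus a point of \<open>E\<close>, which serves as representative.\<close>

lemma low_set_decay:
  fixes f :: "real^'n \<Rightarrow> real^'n"
  assumes d: "distortion H E f" and bd: "bounded (f ` E)" and E: "E \<in> sets borel" "E \<subseteq> unit_cube"
    and \<tau>: "0 < \<tau>" and e: "0 < \<epsilon>" "\<epsilon> \<le> 1" and C: "1 \<le> C"
    and parent: "\<And>k x. thick \<tau> E (Suc k) x \<Longrightarrow> osc E f k x \<le> C * osc E f (Suc k) x"
    and flat: "flat_cubes_miss H \<tau> \<epsilon> c TYPE('n)"
    and t: "0 < t" "t < diameter (f ` E)"
  shows "measure lborel (low_set \<tau> E f N (\<epsilon> / C * t)) \<le> (1 - c) * measure lborel (low_set \<tau> E f N t)"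
proof -
  let ?d = "CARD('n)"
  define s where "s = \<epsilon> / C * t"
  have st: "s \<le> t"
  proof -
    have "\<epsilon> / C \<le> 1" using e C by (simp add: divide_le_eq)
    then have "s \<le> 1 * t" unfolding s_def using t by (intro mult_right_mono) auto
    then show ?thesis by simp
  qed
  have bdS: "bounded (f ` (E \<inter> X))" for X by (rule bounded_subset[OF bd]) auto
  define Q where "Q = stopped (low \<tau> E f N t) unit_cube"
  note Q = low_set_stopped[of \<tau> E f N t, folded Q_def]
  let ?B = "low_set \<tau> E f N s"
  have local: "measure lborel (?B \<inter> cube q) \<le> (1 - c) * snd q ^ ?d" if q: "q \<in> Q" for q
  proof -
    obtain k x0 where x0: "q = dyad k x0" "x0 \<in> unit_cube" "low \<tau> E f N t k x0" "\<And>j. j < k \<Longrightarrow> \<not> low \<tau> E f N t j x0"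
      using q unfolding Q_def stopped_def by blast
    have kN: "k \<le> N" and thk: "thick \<tau> E k x0" using x0(3) by (auto simp: low_def)
    have "k \<noteq> 0"
    proof
      assume "k = 0"
      then have "osc E f k x0 = diameter (f ` E)"
        using dyad_0[OF x0(2)] E(2) by (simp add: osc_def Int_absorb2)
      then show False using x0(3) t by (simp add: low_def)
    qed
    then obtain k' where k': "k = Suc k'" by (cases k) auto
    have oscq: "t < C * osc E f k x0"
    proof -
      have "\<not> low \<tau> E f N t k' x0" using x0(4) k' by simp
      then have "t < osc E f k' x0" using kN k' thick_mono[OF thk] by (auto simp: low_def)
      also have "\<dots> \<le> C * osc E f k x0" unfolding k' by (rule parent) (use thk k' in simp)
      finally show ?thesis .
    qed
    define F where "F = E \<inter> cube q"
    have oscF: "osc E f k x0 = diameter (f ` F) / snd q" by (simp add: osc_def F_def x0(1))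
    have Fpos: "0 < diameter (f ` F)"
    proof -
      have "0 < C * osc E f k x0" using t oscq by simp
      then show ?thesis using C by (simp add: osc_def F_def x0(1) zero_less_mult_iff)
    qed
    \<comment> \<open>By maximality of \<open>q\<close>, low cubes that meet \<open>q\<close> are contained in it.\<close>
    have below: "k \<le> i" if "y \<in> cube q" "low \<tau> E f N s i y" for y i
    proof (rule ccontr)
      assume "\<not> k \<le> i"
      then have "low \<tau> E f N t i x0"
        using low_mono[OF that(2) st] low_cong'[of y k x0 i \<tau> E f N t] that(1) x0(1) by auto
      then show False using x0(4)[of i] \<open>\<not> k \<le> i\<close> by simp
    qed
    define stp where "stp j x \<longleftrightarrow> k \<le> j \<and> j \<le> N \<and> (low \<tau> E f N s j x \<or> cube (dyad j x) \<inter> ?B = {})" for j x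
    define P where "P = stopped stp (cube q)"
    have sub: "cube (dyad j x) \<subseteq> cube q" if "x \<in> cube q" "k \<le> j" for j x
      using dyad_nested_subset[OF that(2), of x] dyad_eqI[of x k x0] that(1) by (simp add: x0(1))
    have qU: "cube q \<subseteq> unit_cube" unfolding x0(1) by (rule dyad_subset_unit[OF x0(2)])
    have stp_inv: "stp j y = stp j x" if "y \<in> cube (dyad j x)" for j x y
      unfolding stp_def using low_cong[OF that, of \<tau> E f N s] dyad_eqI[OF that] by simp
    have fam: "finite P" "pairwise (\<lambda>p p'. disjnt (cube p) (cube p')) P" "(\<Union>p\<in>P. cube p) = {x \<in> cube q. \<exists>j. stp j x}"
      unfolding P_def
      by (rule stopped_family[where N=N], erule stp_inv, simp add: stp_def, rule qU, use sub stp_def in blast)+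
    have lowB: "x \<in> ?B" if "x \<in> unit_cube" "low \<tau> E f N s i x" for i x
      using that by (auto simp: low_set_def)
    have all: "\<exists>j. stp j x" if x: "x \<in> cube q" for x
    proof (cases "x \<in> ?B")
      case True
      then obtain i where i: "low \<tau> E f N s i x" by (auto simp: low_set_def)
      then have "stp i x" using below[OF x i] by (simp add: stp_def low_def)
      then show ?thesis ..
    next
      case False
      have "cube (dyad N x) \<inter> ?B = {}"
      proof (rule ccontr)
        assume "\<not> ?thesis"
        then obtain y i where y: "y \<in> cube (dyad N x)" "low \<tau> E f N s i y" by (auto simp: low_set_def)
        have "i \<le> N" using y(2) by (simp add: low_def)
        then have "low \<tau> E f N s i x" using low_cong'[OF y(1), of i \<tau> E f N s] y(2) by simp
        then show False using lowB x qU False by blast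
      qed
      then have "stp N x" using kN by (simp add: stp_def)
      then show ?thesis ..
    qed
    have cov: "(\<Union>p\<in>P. cube p) = cube q" unfolding fam(3) using all by blast
    have Pside: "0 < snd p \<and> snd p \<le> snd q" if "p \<in> P" for p
    proof -
      obtain j x where "p = dyad j x" "k \<le> j" using \<open>p \<in> P\<close> by (auto simp: P_def stopped_def stp_def)
      then show ?thesis by (simp add: x0(1) divide_simps power_increasing)
    qed
    have rep: "\<exists>w\<in>F. \<forall>x\<in>cube p. dist x w \<le> 2 * real ?d * snd p" if "p \<in> P" for p
    proof -
      obtain j x where j: "p = dyad j x" "x \<in> cube q" "stp j x" "\<And>i. i < j \<Longrightarrow> \<not> stp i x" 
        using \<open>p \<in> P\<close> by (auto simp: P_def stopped_def)
      have kj: "k \<le> j" "j \<le> N" using j(3) by (auto simp: stp_def)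
      show ?thesis
      proof (cases "j = k")
        case True
        then have pq: "p = q" using j dyad_eqI[of x k x0] by (simp add: x0(1))
        have "F \<noteq> {}" using Fpos by auto
        then obtain w where w: "w \<in> F" by blast
        have "dist x w \<le> 2 * real ?d * snd p" if "x \<in> cube p" for x
        proof -
          have "dist x w \<le> real ?d * snd p" by (rule dist_in_cube) (use w that pq in \<open>auto simp: F_def\<close>)
          also have "\<dots> \<le> 2 * real ?d * snd p" using Pside[OF \<open>p \<in> P\<close>] by (intro mult_right_mono) auto
          finally show ?thesis .
        qed
        with w show ?thesis by blast
      next
        case False
        then obtain j' where j': "j = Suc j'" "k \<le> j'" using kj by (cases j) auto
        have "\<not> stp j' x" using j(4) j' by simp
        then obtain y i where y: "y \<in> cube (dyad j' x)" "low \<tau> E f N s i y"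
          using j' kj by (auto simp: stp_def low_set_def)
        have yq: "y \<in> cube q" using sub[OF j(2) j'(2)] y(1) by blast
        have "\<not> i \<le> j'"
        proof
          assume i: "i \<le> j'"
          then have "low \<tau> E f N s i x" using low_cong'[OF y(1) i, of \<tau> E f N s] y(2) by simp
          moreover have "k \<le> i" by (rule below[OF yq y(2)])
          ultimately have "stp i x" using i j' kj by (simp add: stp_def)
          then show False using j(4) i j' by simp
        qed
        then have "cube (dyad i y) \<subseteq> cube (dyad j' y)" by (intro dyad_nested_subset) simp
        also have "dyad j' y = dyad j' x" by (rule dyad_eqI[OF y(1)])
        finally have sub': "cube (dyad i y) \<subseteq> cube (dyad j' x)" .
        have "\<tau> * (1 / 2 ^ i) ^ ?d \<le> measure lborel (E \<inter> cube (dyad i y))"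
          using y(2) by (simp add: low_def thick_def)
        moreover have "0 < \<tau> * (1 / 2 ^ i) ^ ?d" using \<tau> by simp
        ultimately have "E \<inter> cube (dyad i y) \<noteq> {}" by auto
        then obtain w where w: "w \<in> E" "w \<in> cube (dyad j' x)" using sub' by blast
        have "w \<in> F" using w sub[OF j(2) j'(2)] by (auto simp: F_def)
        moreover have "dist z w \<le> 2 * real ?d * snd p" if "z \<in> cube p" for z
        proof -
          have "z \<in> cube (dyad j' x)" using dyad_nested[of j' j z x] that j j' by simp
          then show ?thesis using dist_in_dyad[OF _ w(2), of z] by (simp add: j(1) j'(1))
        qed
        ultimately show ?thesis by blast
      qed
    qed
    then obtain rep where rep: "\<forall>p\<in>P. rep p \<in> F \<and> (\<forall>x\<in>cube p. dist x (rep p) \<le> 2 * real ?d * snd p)"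
      by metis
    define S where "S = {p \<in> P. \<exists>x\<in>cube q. \<exists>j. p = dyad j x \<and> low \<tau> E f N s j x}"
    have S: "\<tau> * snd p ^ ?d \<le> measure lborel (F \<inter> cube p) \<and>
        diameter (f ` (F \<inter> cube p)) \<le> \<epsilon> * (diameter (f ` F) / snd q) * snd p" if "p \<in> S" for p
    proof -
      obtain j x where j: "p = dyad j x" "x \<in> cube q" "low \<tau> E f N s j x" using \<open>p \<in> S\<close> by (auto simp: S_def)
      have "cube p \<subseteq> cube q" using sub[OF j(2) below[OF j(2,3)]] j(1) by simp
      then have Fp: "F \<inter> cube p = E \<inter> cube p" by (auto simp: F_def)
      have "osc E f j x \<le> \<epsilon> * (t / C)" using j(3) by (simp add: low_def s_def)
      also have "\<dots> \<le> \<epsilon> * osc E f k x0" using oscq C e by (intro mult_left_mono) (auto simp: divide_le_eq mult.commute)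
      finally have "osc E f j x * (1 / 2 ^ j) \<le> \<epsilon> * osc E f k x0 * (1 / 2 ^ j)" by (rule mult_right_mono) simp
      then have "diameter (f ` (E \<inter> cube p)) \<le> \<epsilon> * (diameter (f ` F) / snd q) * snd p"
        unfolding oscF by (simp add: osc_def j(1))
      then show ?thesis unfolding Fp using j(3) by (simp add: low_def thick_def j(1))
    qed
    have "?B \<inter> cube q \<subseteq> (\<Union>p\<in>S. cube p)"
    proof
      fix x assume x: "x \<in> ?B \<inter> cube q"
      then obtain p where p: "p \<in> P" "x \<in> cube p" using cov by blast
      obtain j y where j: "p = dyad j y" "y \<in> cube q" "stp j y" using p(1) by (auto simp: P_def stopped_def)
      have "low \<tau> E f N s j y" using j(3) x p(2) by (auto simp: stp_def j(1))
      then have "p \<in> S" using p(1) j by (auto simp: S_def)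
      then show "x \<in> (\<Union>p\<in>S. cube p)" using p(2) by blast
    qed
    then have "measure lborel (?B \<inter> cube q) \<le> measure lborel (\<Union>p\<in>S. cube p)"
    proof (rule measure_mono_fmeasurable)
      show "(\<Union>p\<in>S. cube p) \<in> fmeasurable lborel"
        by (intro fmeasurable.finite_UN) (use fam(1) Pside in \<open>auto simp: S_def less_imp_le\<close>)
    qed (use low_set_fmeasurable[of \<tau> E f N s] in auto)
    also have "\<dots> = (\<Sum>p\<in>S. snd p ^ ?d)"
    proof (rule disjoint_cubes_sum[symmetric])
      show "pairwise (\<lambda>p p'. disjnt (cube p) (cube p')) S"
        by (rule pairwise_subset[OF fam(2)]) (auto simp: S_def)
    qed (use fam(1) Pside in \<open>auto simp: S_def\<close>)
    also have "\<dots> \<le> (1 - c) * snd q ^ ?d"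
    proof (rule flat[unfolded flat_cubes_miss_def, rule_format])
      show "distortion H F f" by (rule distortion_subset[OF d]) (auto simp: F_def)
      show "\<tau> * snd q ^ ?d \<le> measure lborel F" using thk by (simp add: thick_def F_def x0(1))
      show "bounded (f ` F)" unfolding F_def by (rule bdS)
      show "F \<in> sets borel" using E(1) by (auto simp: F_def)
      show "0 < snd q" by (simp add: x0(1))
      show "adapted_partition F q P rep"
        unfolding adapted_partition_def using fam(1,2) cov rep Pside by blast
      show "flat_cube \<tau> F f (\<epsilon> * (diameter (f ` F) / snd q)) p" if "p \<in> S" for p
        unfolding flat_cube_def by (rule S[OF that])
    qed (use Fpos in \<open>auto simp: F_def S_def\<close>)
    finally show ?thesis .
  qed
  have "?B \<subseteq> low_set \<tau> E f N t" using low_mono[OF _ st] by (force simp: low_set_def)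
  then have "?B = (\<Union>q\<in>Q. ?B \<inter> cube q)" using Q(3) by blast
  then have "measure lborel ?B = measure lborel (\<Union>q\<in>Q. ?B \<inter> cube q)" by simp
  also have "\<dots> \<le> (\<Sum>q\<in>Q. measure lborel (?B \<inter> cube q))"
    by (rule measure_UNION_le) (use Q(1) low_set_fmeasurable[of \<tau> E f N s] in auto)
  also have "\<dots> \<le> (\<Sum>q\<in>Q. (1 - c) * snd q ^ ?d)" by (rule sum_mono) (rule local)
  also have "\<dots> = (1 - c) * measure lborel (\<Union>q\<in>Q. cube q)"
  proof -
    have "0 < snd q" if "q \<in> Q" for q using that by (auto simp: Q_def stopped_def)
    then show ?thesis using disjoint_cubes_sum[OF Q(1) _ Q(2)] by (simp add: sum_distrib_left[symmetric])
  qed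
  finally show ?thesis unfolding Q(3) s_def .
qed

text \<open>The thin set is covered by disjoint dyadic cubes, in each of which \<open>E\<close> has density below \<open>\<tau>\<close>.\<close>

lemma thin_set_bound:
  fixes E :: "(real^'n) set"
  assumes E: "E \<in> sets borel" and \<tau>: "0 \<le> \<tau>"
  shows "E \<inter> thin_set \<tau> E N \<in> fmeasurable lborel" "measure lborel (E \<inter> thin_set \<tau> E N) \<le> \<tau>"
proof -
  let ?d = "CARD('n)"
  define st where "st k x \<longleftrightarrow> k \<le> N \<and> measure lborel (E \<inter> cube (dyad k x)) < \<tau> * (1 / 2 ^ k) ^ ?d" for k and x :: "real^'n"
  define Q where "Q = stopped st unit_cube"
  have Q: "finite Q" "pairwise (\<lambda>p p'. disjnt (cube p) (cube p')) Q" "(\<Union>p\<in>Q. cube p) = {x \<in> unit_cube. \<exists>k. st k x}"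
    unfolding Q_def
    by (rule stopped_family[where N=N], simp add: st_def dyad_eqI, simp add: st_def, simp, use dyad_subset_unit in blast)+
  have thin: "thin_set \<tau> E N = (\<Union>p\<in>Q. cube p)" unfolding Q(3) by (auto simp: thin_set_def st_def)
  have Qs: "0 < snd q" "measure lborel (E \<inter> cube q) \<le> \<tau> * snd q ^ ?d" if "q \<in> Q" for q
    using that by (auto simp: Q_def stopped_def st_def)
  have fm: "(\<Union>p\<in>Q. cube p) \<in> fmeasurable lborel"
    by (intro fmeasurable.finite_UN) (use Q(1) Qs in \<open>auto simp: less_imp_le\<close>)
  show "E \<inter> thin_set \<tau> E N \<in> fmeasurable lborel" unfolding thin
    by (rule fmeasurableI2[OF fm]) (use E Q(1) in auto)
  have "E \<inter> thin_set \<tau> E N = (\<Union>q\<in>Q. E \<inter> cube q)" unfolding thin by auto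
  then have "measure lborel (E \<inter> thin_set \<tau> E N) \<le> (\<Sum>q\<in>Q. measure lborel (E \<inter> cube q))"
    using measure_UNION_le[OF Q(1), of "\<lambda>q. E \<inter> cube q" lborel] E by (auto simp only: sets_lborel intro!: sets.Int cube_borel)
  also have "\<dots> \<le> (\<Sum>q\<in>Q. \<tau> * snd q ^ ?d)" by (intro sum_mono Qs)
  also have "\<dots> = \<tau> * measure lborel (\<Union>q\<in>Q. cube q)"
    using disjoint_cubes_sum[OF Q(1) Qs(1) Q(2)] by (simp add: sum_distrib_left[symmetric])
  also have "\<dots> \<le> \<tau> * measure lborel (unit_cube :: (real^'n) set)"
  proof (intro mult_left_mono measure_mono_fmeasurable \<tau>)
    show "(\<Union>p\<in>Q. cube p) \<subseteq> unit_cube" using Q(3) by auto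
  qed (use Q(1) in auto)
  also have "\<dots> = \<tau>" by (simp add: measure_cube)
  finally show "measure lborel (E \<inter> thin_set \<tau> E N) \<le> \<tau>" .
qed

section \<open>Removal of the bad set, and rescaling to the unit cube\<close>

text \<open>Three sets of measure at most \<open>\<rho> / 3\<close> are removed: points in dyadic cubes that are thin in \<open>E\<close>, points in
thick cubes of very small slope, and points at which the maximal slope is large. If \<open>x\<close> is
not in the last set, \<open>f\<close> is Lipschitz at \<open>x\<close>. If \<open>x\<close> is not in the other two, the slope of
the dyadic cube about \<open>x\<close> of side comparable to \<open>\<bar>x - y\<bar>\<close> is bounded below, and quasisymmetry
bounds \<open>\<bar>f x - f y\<bar>\<close> below by the diameter of its image.\<close>

lemma bilipschitz_after_small_removal:
  fixes H :: "real \<Rightarrow> real" and \<rho> :: real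
  assumes n: "2 \<le> CARD('n::finite)" and H: "\<And>t. 0 < t \<Longrightarrow> 1 \<le> H t" and r: "0 < \<rho>"
  shows "\<exists>A\<ge>1. \<forall>(E :: (real^'n) set) (f :: real^'n \<Rightarrow> real^'n).
     distortion H E f \<longrightarrow> bounded (f ` E) \<longrightarrow> E \<in> sets borel \<longrightarrow> E \<subseteq> unit_cube \<longrightarrow>
     0 < diameter (f ` E) \<longrightarrow>
     (\<exists>G\<subseteq>E. G \<in> sets borel \<and> measure lborel (E - G) \<le> \<rho> \<and>
       (\<forall>x\<in>G. \<forall>y\<in>G. diameter (f ` E) / A * dist x y \<le> dist (f x) (f y) \<and>
          dist (f x) (f y) \<le> A * diameter (f ` E) * dist x y))"
proof -
  let ?d = "CARD('n)"
  define \<omega> where "\<omega> = unit_ball_vol (real ?d)"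
  have w: "0 < \<omega>" unfolding \<omega>_def by (rule unit_ball_vol_pos) simp
  define \<tau> where "\<tau> = min 1 (\<rho> / 3)"
  have \<tau>: "0 < \<tau>" "\<tau> \<le> 1" "\<tau> \<le> \<rho> / 3" using r by (auto simp: \<tau>_def)
  obtain \<epsilon> c where ec: "0 < \<epsilon>" "\<epsilon> \<le> 1" "0 < c" "c < 1"
   and flat: "flat_cubes_miss H \<tau> \<epsilon> c TYPE('n)"
  proof -
    have "\<exists>\<epsilon> c. 0 < \<epsilon> \<and> \<epsilon> \<le> 1 \<and> 0 < c \<and> c < 1 \<and> flat_cubes_miss H \<tau> \<epsilon> c TYPE('n)"
      by (rule flat_cubes_miss_a_fraction[OF n _ \<tau>(1,2)]) (rule H)
    then show thesis using that by blast
  qed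
  define \<beta> where "\<beta> = min 1 (\<tau> / (4 * \<omega>))"
  have b: "0 < \<beta>" "\<beta> \<le> 1" using w \<tau> by (auto simp: \<beta>_def)
  have "\<omega> * \<beta> ^ ?d \<le> \<omega> * \<beta>"
    using power_decreasing[of 1 ?d \<beta>] b w n by (intro mult_left_mono) auto
  also have "\<dots> \<le> \<omega> * (\<tau> / (4 * \<omega>))" using w by (intro mult_left_mono) (auto simp: \<beta>_def)
  finally have wb: "\<omega> * \<beta> ^ ?d < \<tau>" using w \<tau> by simp
  define C where "C = H (2 * ?d / \<beta>)"
  have C: "1 \<le> C" unfolding C_def using b by (intro H) simp
  define \<theta> where "\<theta> = \<epsilon> / C"
  have th: "0 < \<theta>" "\<theta> \<le> 1" using ec C by (auto simp: \<theta>_def divide_le_eq)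
  obtain J where J: "(1 - c) ^ J < \<rho> / 3" using real_arch_pow_inv[of "\<rho> / 3" "1 - c"] r ec by auto
  define k where "k = \<theta> ^ J / 2"
  have k: "0 < k" using th by (simp add: k_def)
  have H1: "1 \<le> H 1" by (rule H) simp
  define M where "M = 40 * H 1 * max 1 (3 * \<omega> / \<rho>)"
  have M: "40 * H 1 \<le> M" "1 \<le> M"
  proof -
    show *: "40 * H 1 \<le> M" unfolding M_def using H1 mult_left_mono[of 1 "max 1 (3 * \<omega> / \<rho>)" "40 * H 1"] by simp
    then show "1 \<le> M" using H1 by simp
  qed
  have MV: "\<omega> * (40 * H 1 / M) ^ ?d \<le> \<rho> / 3"
  proof -
    have "40 * H 1 / M = 1 / max 1 (3 * \<omega> / \<rho>)" using H1 by (simp add: M_def)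
    also have "\<dots> \<le> 1 / (3 * \<omega> / \<rho>)" using w r by (intro divide_left_mono) auto
    finally have 1: "40 * H 1 / M \<le> \<rho> / (3 * \<omega>)" by simp
    have "(40 * H 1 / M) ^ ?d \<le> (40 * H 1 / M) ^ 1" using n M H1 by (intro power_decreasing) auto
    with 1 have "(40 * H 1 / M) ^ ?d \<le> \<rho> / (3 * \<omega>)" by simp
    then have "\<omega> * (40 * H 1 / M) ^ ?d \<le> \<omega> * (\<rho> / (3 * \<omega>))" using w by (intro mult_left_mono) auto
    then show ?thesis using w by simp
  qed
  define A where "A = max (2 * M) (4 * ?d * H 1 / k)"
  have A: "1 \<le> A" "2 * M \<le> A" "4 * ?d * H 1 / k \<le> A" using M by (auto simp: A_def)
  have main: "\<exists>G\<subseteq>E. G \<in> sets borel \<and> measure lborel (E - G) \<le> \<rho> \<and>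
       (\<forall>x\<in>G. \<forall>y\<in>G. diameter (f ` E) / A * dist x y \<le> dist (f x) (f y) \<and>
          dist (f x) (f y) \<le> A * diameter (f ` E) * dist x y)"
    if d: "distortion H E f" and bd: "bounded (f ` E)" and E: "E \<in> sets borel" "E \<subseteq> unit_cube"
      and D: "0 < diameter (f ` E)" for E :: "(real^'n) set" and f :: "real^'n \<Rightarrow> real^'n"
  proof -
    define D where "D = diameter (f ` E)"
    have D0: "0 < D" using D by (simp add: D_def)
    have bdS: "bounded (f ` (E \<inter> X))" for X by (rule bounded_subset[OF bd]) auto
    have Efm: "E \<in> fmeasurable lborel" by (rule fmeasurableI2[OF fmeasurable_cube[of "(0, 1)"] E(2)]) (use E in auto)
    have decay: "measure lborel (low_set \<tau> E f N (\<theta> ^ j * (D / 2))) \<le> (1 - c) ^ j" for N j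
    proof (induction j)
      case 0
      have "measure lborel (low_set \<tau> E f N (D / 2)) \<le> measure lborel (unit_cube :: (real^'n) set)"
        by (rule measure_mono_fmeasurable) (use low_set_fmeasurable[of \<tau> E f N "D / 2"] in \<open>auto simp: low_set_def\<close>)
      then show ?case by (simp add: measure_cube)
    next
      case (Suc j)
      have "measure lborel (low_set \<tau> E f N (\<epsilon> / C * (\<theta> ^ j * (D / 2)))) \<le> (1 - c) * measure lborel (low_set \<tau> E f N (\<theta> ^ j * (D / 2)))"
      proof (rule low_set_decay[OF d bd E \<tau>(1) ec(1,2) C])
        show "osc E f k x \<le> C * osc E f (Suc k) x" if "thick \<tau> E (Suc k) x" for k x
          unfolding C_def by (rule osc_parent[OF d bd \<tau>(1) b(1) _ that]) (use wb in \<open>simp add: \<omega>_def\<close>)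
        have "\<theta> ^ j * (D / 2) \<le> 1 * (D / 2)" using th D0 by (intro mult_right_mono power_le_one) auto
        then show "\<theta> ^ j * (D / 2) < diameter (f ` E)" using D0 by (simp add: D_def)
        show "0 < \<theta> ^ j * (D / 2)" using th D0 by simp
      qed (rule flat)
      also have "\<dots> \<le> (1 - c) * (1 - c) ^ j" using ec by (intro mult_left_mono Suc) auto
      finally show ?case by (simp add: \<theta>_def mult.assoc)
    qed
    define Low where "Low = (\<Union>N. low_set \<tau> E f N (k * D))"
    define Thin where "Thin = (\<Union>N. E \<inter> thin_set \<tau> E N)"
    have Low: "Low \<in> fmeasurable lborel" "measure lborel Low \<le> \<rho> / 3"
    proof -
      have "(\<Union>N\<le>m. low_set \<tau> E f N (k * D)) = low_set \<tau> E f m (k * D)" for m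
      proof (intro equalityI UN_least)
        show "low_set \<tau> E f N (k * D) \<subseteq> low_set \<tau> E f m (k * D)" if "N \<in> {..m}" for N
          unfolding low_set_def low_def using that order_trans[of _ N m] by blast
      qed auto
      then have *: "measure lborel (\<Union>N\<le>m. low_set \<tau> E f N (k * D)) \<le> \<rho> / 3" for m
        using decay[of m J] J by (simp add: k_def mult_ac)
      show "Low \<in> fmeasurable lborel" unfolding Low_def by (rule fmeasurable_countable_Union[OF low_set_fmeasurable *])
      show "measure lborel Low \<le> \<rho> / 3" unfolding Low_def by (rule measure_countable_Union_le[OF low_set_fmeasurable *])
    qed
    have Thin: "Thin \<in> fmeasurable lborel" "measure lborel Thin \<le> \<rho> / 3"
    proof -
      note tb = thin_set_bound[OF E(1) less_imp_le[OF \<tau>(1)]]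
      have "(\<Union>N\<le>m. E \<inter> thin_set \<tau> E N) = E \<inter> thin_set \<tau> E m" for m
      proof (intro equalityI UN_least)
        show "E \<inter> thin_set \<tau> E N \<subseteq> E \<inter> thin_set \<tau> E m" if "N \<in> {..m}" for N
          unfolding thin_set_def using that order_trans[of _ N m] by blast
      qed auto
      then have *: "measure lborel (\<Union>N\<le>m. E \<inter> thin_set \<tau> E N) \<le> \<rho> / 3" for m
        using tb(2)[of m] \<tau>(3) by simp
      show "Thin \<in> fmeasurable lborel" unfolding Thin_def by (rule fmeasurable_countable_Union[OF tb(1) *])
      show "measure lborel Thin \<le> \<rho> / 3" unfolding Thin_def by (rule measure_countable_Union_le[OF tb(1) *])
    qed
    define K where "K = {(x, r). x \<in> E \<and> 0 < r \<and> r \<le> 2 * real ?d \<and> M * D * r < diameter (f ` (E \<inter> ball x r))}"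
    define High where "High = (\<Union>(x,r)\<in>K. ball x r)"
    have MD: "0 < M * D" using M D0 by simp
    note wt = weak_type_estimate[OF d bd MD, of K "2 * real ?d"]
    have High: "High \<in> fmeasurable lborel" "measure lborel High \<le> \<rho> / 3"
    proof -
      show "High \<in> fmeasurable lborel" unfolding High_def by (rule wt) (simp add: K_def)
      have "measure lborel High \<le> unit_ball_vol (real ?d) * (40 * H 1 * diameter (f ` E) / (M * D)) ^ ?d"
        unfolding High_def by (rule wt) (simp add: K_def)
      also have "40 * H 1 * diameter (f ` E) / (M * D) = 40 * H 1 / M" using D0 by (simp add: D_def)
      finally show "measure lborel High \<le> \<rho> / 3" using MV by (simp add: \<omega>_def)
    qed
    define G where "G = E - (Low \<union> Thin \<union> High)"
    have GE: "G \<subseteq> E" by (auto simp: G_def)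
    have Gm: "G \<in> sets borel" using E Low(1) Thin(1) High(1) by (auto simp: G_def fmeasurable_def)
    have loss: "measure lborel (E - G) \<le> \<rho>"
    proof -
      have "measure lborel (E - G) \<le> measure lborel (Low \<union> Thin \<union> High)"
        by (rule measure_mono_fmeasurable) (use E Gm Low Thin High in \<open>auto simp: G_def\<close>)
      also have "\<dots> \<le> measure lborel Low + measure lborel Thin + measure lborel High"
        using measure_Un_le[of "Low \<union> Thin" lborel High] measure_Un_le[of Low lborel Thin]
          fmeasurableD[OF Low(1)] fmeasurableD[OF Thin(1)] fmeasurableD[OF High(1)]
        by auto
      finally show ?thesis using Low Thin High by simp
    qed
    have dE: "dist x y \<le> ?d" if "x \<in> E" "y \<in> E" for x y
      using dist_in_cube[of x "(0, 1)" y] that E(2) by auto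
    have upper: "dist (f x) (f y) \<le> A * D * dist x y" if xy: "x \<in> G" "y \<in> G" for x y
    proof (cases "x = y")
      case False
      let ?r = "2 * dist x y"
      have "x \<notin> High" using xy by (simp add: G_def)
      moreover have "x \<in> ball x ?r" using False by simp
      ultimately have "(x, ?r) \<notin> K" unfolding High_def by blast
      then have "diameter (f ` (E \<inter> ball x ?r)) \<le> M * D * ?r"
        using dE[of x y] xy GE False by (auto simp: K_def)
      moreover have "dist (f x) (f y) \<le> diameter (f ` (E \<inter> ball x ?r))"
        by (rule diameter_bounded_bound[OF bdS]) (use xy GE False in auto)
      ultimately have "dist (f x) (f y) \<le> (2 * M) * (D * dist x y)" by simp
      also have "\<dots> \<le> A * (D * dist x y)" using A D0 by (intro mult_right_mono) auto
      finally show ?thesis by simp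
    qed simp
    have lower: "D / A * dist x y \<le> dist (f x) (f y)" if xy: "x \<in> G" "y \<in> G" for x y
    proof (cases "x = y")
      case False
      have E': "x \<in> E" "y \<in> E" "x \<in> unit_cube" using xy GE E(2) by auto
      have pos: "0 < dist x y" using False by simp
      obtain m0 where "(1 / 2) ^ m0 < dist x y / ?d"
        using real_arch_pow_inv[of "dist x y / ?d" "1 / 2"] pos by auto
      then have ex: "\<exists>m. ?d / 2 ^ m \<le> dist x y"
        by (intro exI[of _ m0]) (simp add: power_one_over field_simps)
      \<comment> \<open>the first level at which the bound \<open>d / 2 ^ m\<close> for the diameter of a cube is at most \<open>dist x y\<close>\<close>
      define m where "m = (LEAST m. ?d / 2 ^ m \<le> dist x y)"
      have m: "?d / 2 ^ m \<le> dist x y" unfolding m_def using ex by (rule LeastI_ex)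
      have m': "dist x y \<le> 2 * ?d / 2 ^ m"
      proof (cases m)
        case 0
        then show ?thesis using dE[OF E'(1,2)] by simp
      next
        case (Suc j)
        have "\<not> ?d / 2 ^ j \<le> dist x y" using not_less_Least[of j "\<lambda>m. ?d / 2 ^ m \<le> dist x y"] Suc by (simp add: m_def)
        then show ?thesis using Suc by simp
      qed
      have "x \<notin> Thin" using xy by (simp add: G_def)
      then have "\<not> measure lborel (E \<inter> cube (dyad j x)) < \<tau> * (1 / 2 ^ j) ^ ?d" for j
        using E' by (auto simp: Thin_def thin_set_def)
      then have "thick \<tau> E m x" by (simp add: thick_def not_less)
      moreover have "x \<notin> Low" using xy by (simp add: G_def)
      then have "\<not> low \<tau> E f m (k * D) m x" using E' unfolding Low_def low_set_def by blast
      ultimately have "k * D < osc E f m x" by (simp add: low_def)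
      also have "osc E f m x \<le> (2 * H 1 * dist (f x) (f y)) * 2 ^ m"
        unfolding osc_def
      proof (rule mult_right_mono)
        have near: "dist (f x) (f z) \<le> H 1 * dist (f x) (f y)" if "z \<in> E \<inter> cube (dyad m x)" for z
        proof (rule distortionD[OF d E'(1) _ E'(2)])
          show "dist x z \<le> 1 * dist x y"
            using dist_in_dyad[of x m x z] that m by simp
        qed (use that in auto)
        show "diameter (f ` (E \<inter> cube (dyad m x))) \<le> 2 * H 1 * dist (f x) (f y)"
        proof (rule diameter_le)
          fix a b assume "a \<in> f ` (E \<inter> cube (dyad m x))" "b \<in> f ` (E \<inter> cube (dyad m x))"
          then obtain z z' where z: "z \<in> E \<inter> cube (dyad m x)" "z' \<in> E \<inter> cube (dyad m x)" "a = f z" "b = f z'" by blast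
          show "norm (a - b) \<le> 2 * H 1 * dist (f x) (f y)"
            using near[OF z(1)] near[OF z(2)] dist_triangle3[of "f z" "f z'" "f x"] z by (simp add: dist_norm)
        qed (use H1 in auto)
      qed simp
      finally have "k * D * dist x y \<le> (2 * H 1 * dist (f x) (f y)) * 2 ^ m * (2 * ?d / 2 ^ m)"
        using m' k D0 H1 by (intro mult_mono[of "k * D"]) auto
      then have 1: "k * D * dist x y \<le> (4 * ?d * H 1) * dist (f x) (f y)" by (simp add: mult_ac)
      have "(4 * ?d * H 1) \<le> A * k" using A(3) k by (simp add: pos_divide_le_eq)
      then have "(4 * ?d * H 1) * dist (f x) (f y) \<le> A * k * dist (f x) (f y)" by (rule mult_right_mono) simp
      with 1 have "k * (D * dist x y) \<le> k * (A * dist (f x) (f y))" by (simp add: mult_ac)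
      then have "D * dist x y \<le> A * dist (f x) (f y)" using k by simp
      then show ?thesis using A(1) by (simp add: pos_divide_le_eq mult.commute)
    qed simp
    show ?thesis
      by (rule exI[of _ G]) (use GE Gm loss upper lower in \<open>simp add: D_def\<close>)
  qed
  show ?thesis
    by (rule exI[of _ A], rule conjI[OF A(1)], intro allI impI) (rule main)
qed

text \<open>If \<open>f\<close> is bi-Lipschitz with constant \<open>A\<close> up to a factor \<open>\<sigma>\<close>, the ratio of the diameters lies between
\<open>\<sigma> / A\<close> and \<open>A \<sigma>\<close>, so it may replace \<open>\<sigma>\<close> at the cost of another factor \<open>A\<close>.\<close>

lemma bi_lipschitz_normalize:
  fixes f :: "'a::metric_space \<Rightarrow> 'b::real_normed_vector"
  assumes A: "1 \<le> A" and s: "0 < \<sigma>" and E: "bounded E" "bounded (f ` E)" and two: "u \<in> E" "v \<in> E" "u \<noteq> v"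
    and bil: "\<And>x y. x \<in> E \<Longrightarrow> y \<in> E \<Longrightarrow> \<sigma> / A * dist x y \<le> dist (f x) (f y) \<and> dist (f x) (f y) \<le> A * \<sigma> * dist x y"
  shows "bi_lipschitz_on (A\<^sup>2) E (\<lambda>x. inverse (diameter (f ` E) / diameter E) *\<^sub>R f x)"
proof -
  have dE: "0 < diameter E"
    using diameter_bounded_bound[OF E(1) two(1,2)] two(3) by (meson less_le_trans zero_less_dist_iff)
  define q where "q = diameter (f ` E) / diameter E"
  have up: "diameter (f ` E) \<le> A * \<sigma> * diameter E"
  proof (rule diameter_le)
    fix a b assume "a \<in> f ` E" "b \<in> f ` E"
    then obtain x y where xy: "x \<in> E" "y \<in> E" "a = f x" "b = f y" by blast
    have "dist a b \<le> A * \<sigma> * dist x y" using bil xy by simp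
    also have "\<dots> \<le> A * \<sigma> * diameter E"
      using A s by (intro mult_left_mono diameter_bounded_bound[OF E(1)] xy) auto
    finally show "norm (a - b) \<le> A * \<sigma> * diameter E" by (simp add: dist_norm)
  qed (use two in auto)
  have lo: "\<sigma> / A * diameter E \<le> diameter (f ` E)"
  proof (rule field_le_epsilon)
    fix e :: real assume e: "0 < e"
    define e' where "e' = min (A / \<sigma> * e) (diameter E / 2)"
    have e': "0 < e'" "e' < diameter E" "\<sigma> / A * e' \<le> e"
    proof -
      show "0 < e'" "e' < diameter E" using e A s dE by (auto simp: e'_def)
      have "\<sigma> / A * e' \<le> \<sigma> / A * (A / \<sigma> * e)" using A s by (intro mult_left_mono) (auto simp: e'_def)
      then show "\<sigma> / A * e' \<le> e" using A s by simp
    qed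
    obtain x y where xy: "x \<in> E" "y \<in> E" "diameter E - e' < dist x y"
      using diameter_lower_bounded[OF E(1), of "diameter E - e'"] e' by auto
    have "\<sigma> / A * diameter E \<le> \<sigma> / A * (dist x y + e')" using xy A s by (intro mult_left_mono) auto
    also have "\<dots> \<le> dist (f x) (f y) + e" using bil[OF xy(1,2)] e'(3) by (simp add: distrib_left)
    also have "dist (f x) (f y) \<le> diameter (f ` E)" by (rule diameter_bounded_bound[OF E(2)]) (use xy in auto)
    finally show "\<sigma> / A * diameter E \<le> diameter (f ` E) + e" by simp
  qed
  have q: "\<sigma> / A \<le> q" "q \<le> A * \<sigma>" using up lo dE by (auto simp: q_def pos_le_divide_eq pos_divide_le_eq)
  have q0: "0 < q" using q(1) s A by (meson divide_pos_pos less_le_trans zero_less_one)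
  show ?thesis unfolding bi_lipschitz_on_def q_def[symmetric]
  proof (intro ballI conjI)
    fix x y assume xy: "x \<in> E" "y \<in> E"
    have d: "dist (inverse q *\<^sub>R f x) (inverse q *\<^sub>R f y) = inverse q * dist (f x) (f y)"
      using q0 by (simp add: dist_norm scaleR_diff_right[symmetric])
    have "q * (inverse (A\<^sup>2) * dist x y) \<le> A * \<sigma> * (inverse (A\<^sup>2) * dist x y)"
      using q(2) by (intro mult_right_mono) auto
    also have "\<dots> = \<sigma> / A * dist x y" using A by (simp add: power2_eq_square field_simps)
    also have "\<dots> \<le> dist (f x) (f y)" using bil xy by blast
    finally show "inverse (A\<^sup>2) * dist x y \<le> dist (inverse q *\<^sub>R f x) (inverse q *\<^sub>R f y)"
      unfolding d using q0 by (simp add: field_simps)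
    have "dist (f x) (f y) \<le> A * \<sigma> * dist x y" using bil xy by blast
    also have "\<dots> = A\<^sup>2 * (\<sigma> / A) * dist x y" using A by (simp add: power2_eq_square)
    also have "\<dots> \<le> A\<^sup>2 * q * dist x y" by (intro mult_right_mono mult_left_mono q(1)) auto
    finally show "dist (inverse q *\<^sub>R f x) (inverse q *\<^sub>R f y) \<le> A\<^sup>2 * dist x y"
      unfolding d using q0 by (simp add: field_simps)
  qed
qed

lemma lmeasurable_inner_compact:
  fixes S :: "'a::euclidean_space set"
  assumes S: "S \<in> sets lebesgue" "bounded S" and e: "0 < e"
  obtains T where "compact T" "T \<subseteq> S" "measure lebesgue S - e \<le> measure lebesgue T"
proof -
  obtain T where T: "closed T" "T \<subseteq> S" "S - T \<in> lmeasurable" "emeasure lebesgue (S - T) < ennreal e"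
    using sets_lebesgue_inner_closed[OF S(1) e] by blast
  have cT: "compact T" using T S(2) by (meson bounded_subset compact_eq_bounded_closed)
  have "measure lebesgue (S - T) \<le> e"
    using T(3,4) e by (metis emeasure_eq_measure2 ennreal_less_iff less_imp_le measure_nonneg)
  moreover have "measure lebesgue S \<le> measure lebesgue (T \<union> (S - T))"
    by (rule measure_mono_fmeasurable) (use S fmeasurable.Un[OF lmeasurable_compact[OF cT] T(3)] in auto)
  moreover have "measure lebesgue (T \<union> (S - T)) \<le> measure lebesgue T + measure lebesgue (S - T)"
    by (rule measure_Un_le) (use T cT lmeasurable_compact in auto)
  ultimately show thesis using that[of T] cT T(2) by simp
qed

lemma distortion_similarity:
  assumes d: "distortion H E f" and s: "0 < s" and g: "\<And>x. x \<in> F \<Longrightarrow> g x \<in> E"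
    and sim: "\<And>x y. dist (g x) (g y) = s * dist x y"
  shows "distortion H F (\<lambda>x. f (g x))"
  unfolding distortion_def
proof (intro conjI allI impI ballI)
  fix x y z and t :: real assume "x \<in> F" "y \<in> F" "z \<in> F" "0 < t" and le: "dist x y \<le> t * dist x z"
  moreover have "s * dist x y \<le> s * (t * dist x z)" using le s by (intro mult_left_mono) auto
  ultimately show "dist (f (g x)) (f (g y)) \<le> H t * dist (f (g x)) (f (g z))"
    by (intro distortionD[OF d] g) (auto simp: sim mult_ac)
qed (rule distortion_ge_1[OF d])

text \<open>A rotated cube lies in a ball about one of its corners, and its volume is comparable to that of the
ball. This is all that matters about it, because it may be replaced by a larger axis-parallel cube if \<open>\<delta>\<close> is decreased accordingly.\<close>

lemma is_cubeE:
  fixes Q :: "(real^'n) set"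
  assumes "is_cube Q"
  obtains a and s :: real where "0 < s" "compact Q" "Q \<subseteq> cball a (real CARD('n) * s)"
    "unit_ball_vol (CARD('n)) * (s / 2) ^ CARD('n) \<le> measure lebesgue Q"
proof -
  obtain a s and T :: "real^'n \<Rightarrow> real^'n" where s: "0 < s" and T: "orthogonal_transformation T"
    and Q: "Q = (\<lambda>x. a + T x) ` cbox 0 (\<chi> i. s)"
    using assms unfolding is_cube_def by blast
  define c :: "real^'n" where "c = (\<chi> i. s / 2)"
  have lin: "linear T" using T by (rule orthogonal_transformation_linear)
  have cQ: "compact Q" unfolding Q
    by (intro compact_continuous_image continuous_intros linear_continuous_on linear_conv_bounded_linear[THEN iffD1] lin) auto
  have "Q \<subseteq> cball a (real CARD('n) * s)"
  proof
    fix y assume "y \<in> Q"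
    then obtain x where x: "x \<in> cbox 0 (\<chi> i. s)" "y = a + T x" unfolding Q by blast
    have "dist x 0 \<le> CARD('n) * s"
    proof (rule dist_le_CARD)
      fix i have "0 \<le> x $ i" "x $ i \<le> s" using x(1) by (simp_all add: mem_box_cart)
      then show "\<bar>x $ i - 0 $ i\<bar> \<le> s" by simp
    qed
    then show "y \<in> cball a (CARD('n) * s)"
      using orthogonal_transformation_norm[OF T, of x] by (simp add: x dist_norm)
  qed
  moreover have "ball (a + T c) (s / 2) \<subseteq> Q"
  proof
    fix y assume y: "y \<in> ball (a + T c) (s / 2)"
    obtain x where x: "y - a = T x" using orthogonal_transformation_surj[OF T] by (metis surjD)
    have "norm (x - c) = norm (T (x - c))" using orthogonal_transformation_norm[OF T] by simp
    also have "T (x - c) = y - (a + T c)" using x by (simp add: linear_diff[OF lin] algebra_simps)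
    finally have n: "norm (x - c) < s / 2" using y by (simp add: dist_norm norm_minus_commute)
    have "\<bar>x $ i - s / 2\<bar> < s / 2" for i
      using le_less_trans[OF component_le_norm_cart[of "x - c" i] n] by (simp add: c_def)
    then have "0 \<le> x $ i \<and> x $ i \<le> s" for i by (smt (verit) field_sum_of_halves)
    then have "x \<in> cbox 0 (\<chi> i. s)" by (simp add: mem_box_cart)
    moreover have "y = a + T x" using x by (simp add: algebra_simps)
    ultimately show "y \<in> Q" unfolding Q by blast
  qed
  then have "measure lebesgue (ball (a + T c) (s / 2)) \<le> measure lebesgue Q"
    by (rule measure_mono_fmeasurable) (use lmeasurable_compact[OF cQ] in auto)
  then have "unit_ball_vol (CARD('n)) * (s / 2) ^ CARD('n) \<le> measure lebesgue Q"
    using s by (simp add: content_ball)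
  ultimately show thesis using that[OF s cQ] by blast
qed

lemma infinite_of_positive_measure:
  fixes S :: "'a::euclidean_space set"
  assumes "0 < measure lebesgue S"
  shows "infinite S"
proof
  assume "finite S"
  then have "negligible S" by (rule negligible_finite)
  then show False using assms by (simp add: negligible_imp_measure0)
qed

theorem proposition1p6:
  fixes \<eta> :: "real \<Rightarrow> real" and \<rho> \<delta> :: real
  assumes "2 \<le> CARD('n::finite)"
    and "0 < \<rho>" and "\<rho> < 1/2"
    and "0 < \<delta>"
    and "increasing_homeomorphism \<eta>"
  shows "\<exists>L\<ge>1. \<forall>(Q\<^sub>0 :: (real^'n) set) E (f :: real^'n \<Rightarrow> real^'n).
           is_cube Q\<^sub>0 \<longrightarrow> E \<in> sets lebesgue \<longrightarrow> E \<subseteq> Q\<^sub>0 \<longrightarrow>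
           measure lebesgue E / measure lebesgue Q\<^sub>0 = \<delta> \<longrightarrow>
           quasisymmetric_on \<eta> E f \<longrightarrow>
           (\<exists>E'. compact E' \<and> E' \<subseteq> E \<and>
                 (1 - \<rho>) * measure lebesgue E \<le> measure lebesgue E' \<and>
                 bi_lipschitz_on L E'
                   (\<lambda>x. inverse (diameter (f ` E') / diameter E') *\<^sub>R f x))"
proof -
  let ?d = "CARD('n)"
  \<comment> \<open>a lower bound for the density of \<open>E\<close> in an axis-parallel cube that contains \<open>Q\<^sub>0\<close>\<close>
  define \<delta>' where "\<delta>' = \<delta> * unit_ball_vol ?d / (8 * ?d) ^ ?d"
  have \<delta>': "0 < \<delta>'" using assms(4) by (simp add: \<delta>'_def unit_ball_vol_pos)
  define e where "e = \<rho> * \<delta>' / 3"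
  have e: "0 < e" using assms(2) \<delta>' by (simp add: e_def)
  obtain A where A: "1 \<le> A" and core: "\<And>(E :: (real^'n) set) (f :: real^'n \<Rightarrow> real^'n).
     distortion (\<lambda>t. max 1 (\<eta> t)) E f \<Longrightarrow> bounded (f ` E) \<Longrightarrow> E \<in> sets borel \<Longrightarrow> E \<subseteq> unit_cube \<Longrightarrow>
     0 < diameter (f ` E) \<Longrightarrow>
     \<exists>G\<subseteq>E. G \<in> sets borel \<and> measure lborel (E - G) \<le> e \<and>
       (\<forall>x\<in>G. \<forall>y\<in>G. diameter (f ` E) / A * dist x y \<le> dist (f x) (f y) \<and>
          dist (f x) (f y) \<le> A * diameter (f ` E) * dist x y)"
    using bilipschitz_after_small_removal[where 'n='n, OF assms(1) _ e, of "\<lambda>t. max 1 (\<eta> t)"] by auto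
  have main: "\<exists>E'. compact E' \<and> E' \<subseteq> E \<and> (1 - \<rho>) * measure lebesgue E \<le> measure lebesgue E' \<and>
      bi_lipschitz_on (A\<^sup>2) E' (\<lambda>x. inverse (diameter (f ` E') / diameter E') *\<^sub>R f x)"
    if Q: "is_cube Q" and E: "E \<in> sets lebesgue" "E \<subseteq> Q" and dens: "measure lebesgue E / measure lebesgue Q = \<delta>"
      and qs: "quasisymmetric_on \<eta> E f" for Q E :: "(real^'n) set" and f :: "real^'n \<Rightarrow> real^'n"
  proof -
    obtain a and s :: real where s: "0 < s" and cQ: "compact Q" and Qs: "Q \<subseteq> cball a (?d * s)"
      and Qm: "unit_ball_vol ?d * (s / 2) ^ ?d \<le> measure lebesgue Q"
      by (rule is_cubeE[OF Q])
    \<comment> \<open>\<open>g\<close> maps the unit cube onto an axis-parallel cube that contains \<open>Q\<close> in its interior.\<close>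
    define s' where "s' = 4 * ?d * s"
    have s': "0 < s'" using s by (simp add: s'_def)
    define b where "b = a - (\<chi> i. 2 * ?d * s)"
    define g where "g x = s' *\<^sub>R x + b" for x
    have sim: "dist (g x) (g y) = s' * dist x y" for x y
      using s' by (simp add: g_def dist_norm scaleR_diff_right[symmetric])
    define E1 where "E1 = g -` E"
    have gE1: "g ` E1 = E"
    proof -
      have "y = g ((1 / s') *\<^sub>R (y - b))" for y using s' by (simp add: g_def)
      then have "surj g" unfolding surj_def by blast
      then show ?thesis unfolding E1_def by (rule surj_image_vimage_eq)
    qed
    have meas: "measure lebesgue (g ` X) = s' ^ ?d * measure lebesgue X" for X
      using measure_lebesgue_affine[of s' b X] s' by (simp add: g_def)
    have E1: "E1 \<in> sets lebesgue"
    proof -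
      have "(*\<^sub>R) s' -` ((+) (- b) ` E) \<inter> space lebesgue \<in> sets lebesgue"
        by (rule measurable_sets[OF lebesgue_measurable_scaling lebesgue_sets_translation[OF E(1)]])
      also have "(*\<^sub>R) s' -` ((+) (- b) ` E) \<inter> space lebesgue = E1"
      proof -
        have "(+) (- b) ` E = {y. y + b \<in> E}"
          by (auto intro!: image_eqI[of _ _ "_ + b"])
        then show ?thesis by (simp add: E1_def g_def vimage_def)
      qed
      finally show ?thesis .
    qed
    have E1U: "E1 \<subseteq> unit_cube"
    proof
      fix x assume "x \<in> E1"
      then have "g x \<in> cball a (?d * s)" using E Qs by (auto simp: E1_def)
      then have n: "norm (g x - a) \<le> ?d * s" by (simp add: dist_norm norm_minus_commute)
      have "\<bar>s' * x $ i - 2 * ?d * s\<bar> \<le> ?d * s" for i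
        using order_trans[OF component_le_norm_cart[of "g x - a" i] n] by (simp add: g_def b_def)
      moreover have ds: "0 < ?d * s" using s by simp
      ultimately have near: "\<bar>s' * x $ i - 2 * (?d * s)\<bar> \<le> ?d * s" for i by (simp add: mult.assoc)
      have s'4: "s' = 4 * (?d * s)" by (simp add: s'_def)
      have "0 \<le> s' * x $ i \<and> s' * x $ i < s' * 1" for i
        using near[of i] ds s'4 unfolding abs_le_iff by linarith
      then have "0 \<le> x $ i \<and> x $ i < 1" for i
        using s' by (simp add: zero_le_mult_iff)
      then show "x \<in> unit_cube" by (simp add: cube_def)
    qed
    have mE1: "\<delta>' \<le> measure lebesgue E1"
    proof -
      have "0 < unit_ball_vol ?d * (s / 2) ^ ?d" using s by (simp add: unit_ball_vol_pos)
      then have "measure lebesgue E = \<delta> * measure lebesgue Q" using dens Qm by (auto simp: divide_eq_eq)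
      moreover have "\<delta> * (unit_ball_vol ?d * (s / 2) ^ ?d) \<le> \<delta> * measure lebesgue Q"
        by (rule mult_left_mono[OF Qm]) (use assms(4) in simp)
      moreover have "measure lebesgue E = s' ^ ?d * measure lebesgue E1"
        using meas[of E1] by (simp add: gE1)
      ultimately have "\<delta> * (unit_ball_vol ?d * (s / 2) ^ ?d) \<le> s' ^ ?d * measure lebesgue E1"
        by linarith
      moreover have "\<delta> * (unit_ball_vol ?d * (s / 2) ^ ?d) = s' ^ ?d * \<delta>'"
      proof -
        have "s / 2 = s' / (8 * ?d)" by (simp add: s'_def)
        then show ?thesis by (simp add: \<delta>'_def power_divide)
      qed
      ultimately show ?thesis using s' by simp
    qed
    have bE1: "bounded E1"
    proof (rule bounded_subset[OF bounded_cbox])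
      show "E1 \<subseteq> cbox 0 (\<chi> i. 1)"
        using E1U by (auto simp: cube_def mem_box_cart less_imp_le)
    qed
    obtain E2 where E2: "compact E2" "E2 \<subseteq> E1" "measure lebesgue E1 - e \<le> measure lebesgue E2"
      using lmeasurable_inner_compact[OF E1 bE1 e] .
    have E2b: "E2 \<in> sets borel" by (rule borel_compact[OF E2(1)])
    have "e \<le> \<delta>' / 6" using assms(3) \<delta>' by (simp add: e_def)
    then have "0 < measure lebesgue E2" using E2(3) mE1 \<delta>' by simp
    then have inf: "infinite E2" by (rule infinite_of_positive_measure)
    define F where "F x = f (g x)" for x
    have d: "distortion (\<lambda>t. max 1 (\<eta> t)) E2 F"
      unfolding F_def
      by (rule distortion_similarity[OF quasisymmetric_imp_distortion[OF assms(5) qs] s' _ sim])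
         (use E2(2) in \<open>auto simp: E1_def\<close>)
    have bF: "bounded (F ` E2)" by (rule distortion_bounded_image[OF d compact_imp_bounded[OF E2(1)]])
    have D: "0 < diameter (F ` E2)"
    proof -
      obtain X where "X \<subseteq> E2" "card X = 3" using infinite_arbitrarily_large[OF inf, of 3] by blast
      then obtain x y z where xyz: "x \<in> E2" "y \<in> E2" "z \<in> E2" "x \<noteq> y" "y \<noteq> z" "x \<noteq> z"
        by (auto simp: card_3_iff)
      have inj: "g u \<noteq> g v" if "u \<noteq> v" for u v using sim[of u v] s' that by auto
      have "g x \<in> E" "g y \<in> E" "g z \<in> E" using xyz E2(2) by (auto simp: E1_def)
      then have "F x \<noteq> F z"
        using qs inj xyz(4-6) unfolding quasisymmetric_on_def F_def by blast
      then have "0 < dist (F x) (F z)" by simp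
      also have "\<dots> \<le> diameter (F ` E2)" by (rule diameter_bounded_bound[OF bF]) (use xyz in auto)
      finally show ?thesis .
    qed
    have "E2 \<subseteq> unit_cube" using E2(2) E1U by (rule subset_trans)
    from core[OF d bF E2b this D] obtain G where G: "G \<subseteq> E2" "G \<in> sets borel" "measure lborel (E2 - G) \<le> e"
      and bil: "\<And>x y. x \<in> G \<Longrightarrow> y \<in> G \<Longrightarrow> diameter (F ` E2) / A * dist x y \<le> dist (F x) (F y) \<and>
          dist (F x) (F y) \<le> A * diameter (F ` E2) * dist x y"
      by blast
    have bG: "bounded G" by (rule bounded_subset[OF compact_imp_bounded[OF E2(1)] G(1)])
    have G': "G \<in> sets lebesgue" using G(2) by simp
    obtain E3 where E3: "compact E3" "E3 \<subseteq> G" "measure lebesgue G - e \<le> measure lebesgue E3"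
      using lmeasurable_inner_compact[OF G' bG e] .
    have "measure lebesgue E2 \<le> measure lebesgue (G \<union> (E2 - G))"
      using bounded_set_imp_lmeasurable[OF bG G'] fmeasurable.Diff[OF lmeasurable_compact[OF E2(1)] bounded_set_imp_lmeasurable[OF bG G']]
        lmeasurable_compact[OF E2(1)]
      by (intro measure_mono_fmeasurable) auto
    also have "\<dots> \<le> measure lebesgue G + measure lebesgue (E2 - G)"
      by (rule measure_Un_le) (use G E2b in auto)
    also have "measure lebesgue (E2 - G) = measure lborel (E2 - G)"
      by (rule measure_completion) (use G E2b in auto)
    finally have "measure lebesgue E1 - 3 * e \<le> measure lebesgue E3" using E2(3) E3(3) G(3) by simp
    moreover have "3 * e \<le> \<rho> * measure lebesgue E1"
      using mE1 assms(2) by (simp add: e_def mult_left_mono)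
    ultimately have m3: "(1 - \<rho>) * measure lebesgue E1 \<le> measure lebesgue E3" by (simp add: algebra_simps)
    have "0 < (1 - \<rho>) * measure lebesgue E1" using mE1 \<delta>' assms(3) by simp
    then have "infinite E3" using m3 by (intro infinite_of_positive_measure) simp
    then obtain X where "X \<subseteq> E3" "card X = 2" using infinite_arbitrarily_large[of E3 2] by blast
    then obtain u v where uv: "u \<in> E3" "v \<in> E3" "u \<noteq> v" by (auto simp: card_2_iff)
    define E' where "E' = g ` E3"
    have E'E: "E' \<subseteq> E" unfolding E'_def gE1[symmetric] using E3(2) G(1) E2(2) by blast
    have cE': "compact E'" unfolding E'_def g_def
      by (intro compact_continuous_image continuous_intros E3)
    have "f ` E' \<subseteq> F ` E2" using E3(2) G(1) by (auto simp: E'_def F_def)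
    then have bE': "bounded (f ` E')" using bF by (rule bounded_subset[rotated])
    have "bi_lipschitz_on (A\<^sup>2) E' (\<lambda>x. inverse (diameter (f ` E') / diameter E') *\<^sub>R f x)"
    proof (rule bi_lipschitz_normalize[OF A, of "diameter (F ` E2) / s'"])
      show "g u \<in> E'" "g v \<in> E'" "g u \<noteq> g v" using uv sim[of u v] s' by (auto simp: E'_def)
      fix x y assume "x \<in> E'" "y \<in> E'"
      then obtain x' y' where xy: "x' \<in> E3" "y' \<in> E3" "x = g x'" "y = g y'" unfolding E'_def by blast
      show "diameter (F ` E2) / s' / A * dist x y \<le> dist (f x) (f y) \<and>
            dist (f x) (f y) \<le> A * (diameter (F ` E2) / s') * dist x y"
        using bil[of x' y'] xy E3(2) s' by (auto simp: F_def sim mult.assoc)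
    qed (use D s' cE' bE' in \<open>auto intro: compact_imp_bounded\<close>)
    moreover have "(1 - \<rho>) * measure lebesgue E \<le> measure lebesgue E'"
    proof -
      have "s' ^ ?d * ((1 - \<rho>) * measure lebesgue E1) \<le> s' ^ ?d * measure lebesgue E3"
        using m3 s' by (intro mult_left_mono) auto
      then show ?thesis using meas[of E1] meas[of E3] by (simp add: gE1 E'_def mult_ac)
    qed
    ultimately show ?thesis using cE' E'E by blast
  qed
  show ?thesis
  proof (rule exI[of _ "A\<^sup>2"], intro conjI allI impI)
    show "1 \<le> A\<^sup>2" using A by (rule one_le_power)
  qed (rule main)
qed

end
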